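(* For every integer $n\ge1$ the following identity of formal power series in $q,t$ holds: $$\frac1{n!}\,\frac{(1-qt)^n}{(1-q)^n(1-t)^n}\ \mathrm{CT}\prod_{1\le i\ne j\le n}\frac{(1-qt\,u_i/u_j)(1-u_i/u_j)}{(1-q\,u_i/u_j)(1-t\,u_i/u_j)}\;=\;\sum_{j=0}^n\frac{t^j}{(q;q)_{n-j}\,(t;t)_j}.$$
   Context: $\mathrm{CT}:\mathbb Z[u_1^{\pm1},\dots,u_n^{\pm1}][[q,t]]\to\mathbb Z[[q,t]]$ is the constant term map in the variables $u_1,\dots,u_n$ (rational functions are expanded as power series in $q,t$ with Laurent polynomial coefficients in the $u_i$). $(v;q)_m:=\prod_{j=0}^{m-1}(1-q^jv)$, so $(q;q)_m=\prod_{j=1}^m(1-q^j)$, $(q;q)_0=1$. *)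

theory Defs
  imports
    "HOL-Library.Poly_Mapping"
    "HOL-Computational_Algebra.Formal_Power_Series"
begin

text \<open>
  Laurent polynomials with coefficients in \<open>'a\<close>: finitely supported functions on exponent vectors,
  which are themselves finitely supported functions from indices to \<^typ>\<open>int\<close>, so that
  multiplication is the group-algebra convolution. Indices range over all of \<^typ>\<open>nat\<close>;
  the ring in \<open>u\<^sub>1, \<dots>, u\<^sub>n\<close> is the subring generated by \<open>u i\<close> and their
  inverses for \<open>1 \<le> i \<le> n\<close>.
\<close>

type_synonym 'a laurent_poly = "(nat \<Rightarrow>\<^sub>0 int) \<Rightarrow>\<^sub>0 'a"

definition laurent_var :: "nat \<Rightarrow> 'a::comm_ring_1 laurent_poly"
  where "laurent_var i = Poly_Mapping.single (Poly_Mapping.single i 1) 1"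

text \<open>
  \<open>R[[q,t]]\<close> is represented as \<open>R[[q]][[t]]\<close>: the coefficient of \<open>q\<^sup>a t\<^sup>b\<close> in \<open>F\<close> is
  \<open>fps_nth (fps_nth F b) a\<close>.
\<close>

type_synonym 'a fps2 = "'a fps fps"

definition var_q :: "'a::comm_ring_1 fps2"
  where "var_q = fps_const fps_X"

definition var_t :: "'a::comm_ring_1 fps2"
  where "var_t = fps_X"

definition var_u :: "nat \<Rightarrow> 'a::comm_ring_1 laurent_poly fps2"
  where "var_u i = fps_const (fps_const (laurent_var i))"

definition constant_term :: "'a::comm_ring_1 laurent_poly fps2 \<Rightarrow> 'a fps2"
  where "constant_term F = Abs_fps (\<lambda>b. Abs_fps (\<lambda>a. Poly_Mapping.lookup (fps_nth (fps_nth F b) a) 0))"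

definition rat_fps2 :: "int fps2 \<Rightarrow> rat fps2"
  where "rat_fps2 F = Abs_fps (\<lambda>b. Abs_fps (\<lambda>a. of_int (fps_nth (fps_nth F b) a)))"

text \<open>
  The inverse of a unit; unspecified on non-units. The library's \<^const>\<open>inverse\<close> on
  \<^typ>\<open>'a fps\<close> needs an \<open>inverse\<close> operation on the coefficients, which Laurent polynomials
  do not have. Every power series whose constant coefficient is a unit is itself a unit, so
  this yields the expansion of a rational function in powers of \<open>q\<close> and \<open>t\<close>.
\<close>

definition unit_inverse :: "'a::comm_ring_1 \<Rightarrow> 'a"
  where "unit_inverse x = (THE y. x * y = 1)"

definition unit_divide :: "'a::comm_ring_1 \<Rightarrow> 'a \<Rightarrow> 'a"  (infixl \<open>\<oslash>\<close> 70)
  where "x \<oslash> y = x * unit_inverse y"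

definition q_pochhammer :: "'a::comm_ring_1 \<Rightarrow> 'a \<Rightarrow> nat \<Rightarrow> 'a"
  where "q_pochhammer v q m = (\<Prod>j<m. 1 - q ^ j * v)"

text \<open>The factors of the denominators in the identity are units.\<close>

lemma unit_inverse_eqI:
  assumes "x * y = 1"
  shows "unit_inverse x = y"
  unfolding unit_inverse_def
proof (rule the_equality)
  show "x * y = 1" by fact
  show "z = y" if "x * z = 1" for z
    using assms that by (metis mult.assoc mult.commute mult.right_neutral)
qed

lemma mult_unit_inverse:
  assumes "x dvd 1"
  shows "x * unit_inverse x = 1"
  using assms unit_inverse_eqI by (metis dvdE)

lemma fps_unit_if_nth_0_unit:
  fixes f :: "'a::comm_ring_1 fps"
  assumes "fps_nth f 0 dvd 1"
  shows "f dvd 1"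
  using assms fps_right_inverse by (metis dvdE dvdI)

lemma unit_laurent_var: "(laurent_var i :: 'a::comm_ring_1 laurent_poly) dvd 1"
proof -
  have "laurent_var i * Poly_Mapping.single (- Poly_Mapping.single i 1) (1::'a) = 1"
    by (simp add: laurent_var_def mult_single flip: single_one)
  then show ?thesis by (metis dvdI)
qed

lemma unit_var_u: "(var_u i :: 'a::comm_ring_1 laurent_poly fps2) dvd 1"
  by (simp add: var_u_def fps_unit_if_nth_0_unit unit_laurent_var)

lemma var_u_divide:
  "(var_u i :: 'a::comm_ring_1 laurent_poly fps2) \<oslash> var_u j =
     fps_const (fps_const (Poly_Mapping.single (Poly_Mapping.single i 1 - Poly_Mapping.single j 1) 1))"
proof -
  have "unit_inverse (var_u j :: 'a laurent_poly fps2) =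
      fps_const (fps_const (Poly_Mapping.single (- Poly_Mapping.single j 1) 1))"
    by (rule unit_inverse_eqI) (simp add: var_u_def laurent_var_def mult_single flip: single_one)
  then show ?thesis
    by (simp add: unit_divide_def var_u_def laurent_var_def mult_single)
qed

lemma unit_1_minus_var_q: "1 - var_q * x dvd (1 :: 'a::comm_ring_1 fps2)"
  by (rule fps_unit_if_nth_0_unit, rule fps_unit_if_nth_0_unit) (simp add: var_q_def)

lemma unit_1_minus_var_t: "1 - var_t * x dvd (1 :: 'a::comm_ring_1 fps2)"
  by (rule fps_unit_if_nth_0_unit) (simp add: var_t_def)

lemma unit_q_pochhammer_var:
  "q_pochhammer var_q var_q m dvd (1 :: 'a::comm_ring_1 fps2)"
  "q_pochhammer var_t var_t m dvd (1 :: 'a::comm_ring_1 fps2)"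
proof -
  have unit_prod: "prod f A dvd 1" if "\<And>j. f j dvd 1" for f :: "nat \<Rightarrow> 'a fps2" and A
    using that by (induction A rule: infinite_finite_induct) (auto simp: dvd_def, metis mult.left_commute mult.right_neutral)
  show "q_pochhammer var_q var_q m dvd (1 :: 'a fps2)" "q_pochhammer var_t var_t m dvd (1 :: 'a fps2)"
    unfolding q_pochhammer_def
    by (rule unit_prod, simp add: mult.commute unit_1_minus_var_q unit_1_minus_var_t)+
qed

lemma unit_of_nat_fact: "of_nat (fact n) dvd (1 :: rat fps2)"
proof (rule dvdI)
  show "(1 :: rat fps2) = of_nat (fact n) * fps_const (fps_const (inverse (of_nat (fact n))))"
    by (simp flip: fps_of_nat)
qed

end

theory Submission
  imports Defs "HOL-Combinatorics.Transposition" "HOL-Computational_Algebra.Polynomial"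
begin

text \<open>
  The product over \<open>i \<noteq> j\<close> is the Hall--Littlewood weight with parameter \<open>t\<close> times a Cauchy
  kernel \<open>K(u, 1/u)\<close>, \<open>K(x, 1/y) = \<Prod> (1 - q t x\<^sub>i / y\<^sub>j) / (1 - q x\<^sub>i / y\<^sub>j)\<close>, restricted to the
  diagonal \<open>x = y\<close>. Since \<open>K\<close> is symmetric, the symmetric weight may be replaced by the triangular
  one, \<open>\<Prod>\<^sub>i\<^sub><\<^sub>j (1 - y\<^sub>i / y\<^sub>j) / (1 - t y\<^sub>i / y\<^sub>j)\<close>. For this weight \<open>K\<close> is a reproducing kernel up
  to scalars: taking residues in one \<open>y\<close> at a time shows that a monomial symmetric function with
  \<open>l\<close> positive parts is reproduced with the factor \<open>(t;t)\<^sub>n / (t;t)\<^sub>n\<^sub>-\<^sub>l\<close>. The constant term on the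
  diagonal is the trace of this operator, so the left-hand side is \<open>\<Sum>\<^sub>l e\<^sub>l / (t;t)\<^sub>n\<^sub>-\<^sub>l\<close> with
  coefficients \<open>e\<^sub>l\<close> that depend neither on \<open>t\<close> nor on \<open>n\<close>. At \<open>t = 0\<close> the weight and the kernel
  combine to a Hall--Littlewood weight with parameter \<open>q\<close>, which gives
  \<open>\<Sum>\<^sub>l\<^sub>\<le>\<^sub>n e\<^sub>l = 1 / (q;q)\<^sub>n\<close> and hence determines the \<open>e\<^sub>l\<close>.

  To express the trace, a second set of variables \<open>x\<close> is used together with the geometric series
  in \<open>s y\<^sub>i / x\<^sub>i\<close>; taking the constant term in \<open>x\<close> then replaces \<open>x\<^sub>i\<close> by \<open>s y\<^sub>i\<close>, and \<open>q\<close> by \<open>q s\<close>. As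
  only \<open>q\<close> and \<open>t\<close> are available as small parameters, \<open>s\<close> is taken to be \<open>q\<close>: the identity is
  proved with \<open>q\<^sup>2\<close> in place of \<open>q\<close>, which suffices.
\<close>

abbreviation "lookup \<equiv> Poly_Mapping.lookup"
abbreviation "keys \<equiv> Poly_Mapping.keys"

section \<open>Ring homomorphisms acting on coefficients\<close>

text \<open>Instantiated by renamings of variables, the embedding of \<open>int fps2\<close> into
  \<open>lser\<close>, the passage to rational coefficients and the substitution of q^2 for q; each
  transports whole identities, including quotients by units.\<close>

locale unital_ring_hom =
  fixes h :: "'a::comm_ring_1 \<Rightarrow> 'b::comm_ring_1"
  assumes hom_one: "h 1 = 1"
    and hom_add: "h (x + y) = h x + h y"
    and hom_mult: "h (x * y) = h x * h y"
begin

lemma hom_zero: "h 0 = 0"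
  using hom_add[of 0 0] by simp

lemma hom_uminus: "h (- x) = - h x"
  using hom_add[of x "- x"] by (simp add: hom_zero eq_neg_iff_add_eq_0 add.commute)

lemma hom_diff: "h (x - y) = h x - h y"
  using hom_add[of x "- y"] by (simp add: hom_uminus)

lemma hom_sum: "h (sum f A) = (\<Sum>x\<in>A. h (f x))"
  by (induction A rule: infinite_finite_induct) (simp_all add: hom_zero hom_add)

lemma hom_prod: "h (prod f A) = (\<Prod>x\<in>A. h (f x))"
  by (induction A rule: infinite_finite_induct) (simp_all add: hom_one hom_mult)

lemma hom_power: "h (x ^ n) = h x ^ n"
  by (induction n) (simp_all add: hom_one hom_mult)

lemma hom_of_nat: "h (of_nat n) = of_nat n"
  by (induction n) (simp_all add: hom_zero hom_one hom_add)

lemma hom_unit_inverse: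
  assumes "x dvd 1"
  shows "h (unit_inverse x) = unit_inverse (h x)"
proof -
  have "h x * h (unit_inverse x) = 1"
    by (metis assms hom_mult hom_one mult_unit_inverse)
  then show ?thesis by (simp add: unit_inverse_eqI)
qed

lemma hom_unit_divide:
  assumes "y dvd 1"
  shows "h (x \<oslash> y) = h x \<oslash> h y"
  using assms by (simp add: unit_divide_def hom_mult hom_unit_inverse)

lemma hom_q_pochhammer: "h (q_pochhammer v q m) = q_pochhammer (h v) (h q) m"
  by (simp add: q_pochhammer_def hom_prod hom_diff hom_one hom_mult hom_power)

lemma hom_dvd_one: "x dvd 1 \<Longrightarrow> h x dvd 1"
  by (metis dvd_def hom_mult hom_one)

end

lemmas unital_ring_hom_simps =
  unital_ring_hom.hom_zero unital_ring_hom.hom_one unital_ring_hom.hom_add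
  unital_ring_hom.hom_mult unital_ring_hom.hom_uminus unital_ring_hom.hom_diff
  unital_ring_hom.hom_sum unital_ring_hom.hom_prod unital_ring_hom.hom_power
  unital_ring_hom.hom_of_nat unital_ring_hom.hom_q_pochhammer

definition fps_map :: "('a \<Rightarrow> 'b) \<Rightarrow> 'a fps \<Rightarrow> 'b fps"
  where "fps_map h F = Abs_fps (\<lambda>n. h (fps_nth F n))"

lemma fps_map_nth [simp]: "fps_nth (fps_map h F) n = h (fps_nth F n)"
  by (simp add: fps_map_def)

lemma unital_ring_hom_fps_map:
  assumes "unital_ring_hom h"
  shows "unital_ring_hom (fps_map h)"
  by unfold_locales
    (auto simp: fps_eq_iff fps_mult_nth unital_ring_hom_simps[OF assms])

lemma fps_map_const:
  "unital_ring_hom h \<Longrightarrow> fps_map h (fps_const c) = fps_const (h c)"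
  by (auto simp: fps_eq_iff unital_ring_hom.hom_zero)

lemma fps_map_X: "unital_ring_hom h \<Longrightarrow> fps_map h fps_X = fps_X"
  by (auto simp: fps_eq_iff fps_X_def unital_ring_hom.hom_zero unital_ring_hom.hom_one)

lemma fps_map_map_var_q:
  "unital_ring_hom h \<Longrightarrow> fps_map (fps_map h) var_q = var_q"
  by (simp add: var_q_def fps_map_const unital_ring_hom_fps_map fps_map_X)

lemma fps_map_var_t: "unital_ring_hom h \<Longrightarrow> fps_map h var_t = var_t"
  by (simp add: var_t_def fps_map_X)

section \<open>Supports of Laurent series\<close>

type_synonym lser = "int laurent_poly fps2"

text \<open>For a submonoid \<open>M\<close> these series form a subring, closed under
  \<open>iv\<close> of small elements. One notion thus covers series free of certain variables,
  series without negative powers of a variable, and scalars.\<close>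

definition supported :: "(nat \<Rightarrow>\<^sub>0 int) set \<Rightarrow> lser set"
  where "supported M = {F. \<forall>a b. keys (fps_nth (fps_nth F b) a) \<subseteq> M}"

definition mon :: "(nat \<Rightarrow>\<^sub>0 int) \<Rightarrow> lser"
  where "mon e = fps_const (fps_const (Poly_Mapping.single e 1))"

definition submonoid :: "'a::comm_monoid_add set \<Rightarrow> bool"
  where "submonoid M \<longleftrightarrow> 0 \<in> M \<and> (\<forall>a\<in>M. \<forall>b\<in>M. a + b \<in> M)"

lemma lser_eqI:
  fixes F G :: lser
  assumes "\<And>b a k. lookup (fps_nth (fps_nth F b) a) k = lookup (fps_nth (fps_nth G b) a) k"
  shows "F = G"
  using assms by (auto simp: fps_eq_iff intro!: poly_mapping_eqI)

lemma supported_lookup: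
  "F \<in> supported M \<Longrightarrow> k \<notin> M \<Longrightarrow> lookup (fps_nth (fps_nth F b) a) k = 0"
  unfolding supported_def in_keys_iff[symmetric] by (metis (no_types, lifting) in_keys_iff mem_Collect_eq subsetD)

lemma mon_add: "mon (a + b) = mon a * mon b"
  by (simp add: mon_def mult_single)

lemma mon_0 [simp]: "mon 0 = 1"
  by (simp add: mon_def)

lemma mon_minus_cancel [simp]: "mon e * mon (- e) = 1" "mon (- e) * mon e = 1"
  by (simp_all flip: mon_add)

lemma supported_mult:
  assumes "F \<in> supported A" "G \<in> supported B" "\<And>a b. a \<in> A \<Longrightarrow> b \<in> B \<Longrightarrow> a + b \<in> C"
  shows "F * G \<in> supported C"
  unfolding supported_def
proof (intro CollectI allI)
  fix a b
  have 1: "keys (fps_nth (fps_nth F i) i' * fps_nth (fps_nth G j) j') \<subseteq> C" for i i' j j'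
  proof -
    have "keys (fps_nth (fps_nth F i) i') \<subseteq> A" "keys (fps_nth (fps_nth G j) j') \<subseteq> B"
      using assms by (auto simp: supported_def)
    then show ?thesis
      using keys_mult[of "fps_nth (fps_nth F i) i'" "fps_nth (fps_nth G j) j'"] assms(3) by blast
  qed
  show "keys (fps_nth (fps_nth (F * G) b) a) \<subseteq> C"
    unfolding fps_mult_nth fps_sum_nth
    by (rule order.trans[OF keys_sum], rule UN_least, rule order.trans[OF keys_sum], rule UN_least, rule 1)
qed

lemma supported_0 [simp]: "0 \<in> supported M"
  by (simp add: supported_def)

lemma supported_add: "F \<in> supported M \<Longrightarrow> G \<in> supported M \<Longrightarrow> F + G \<in> supported M"
  using keys_add by (fastforce simp: supported_def)

lemma supported_diff: "F \<in> supported M \<Longrightarrow> G \<in> supported M \<Longrightarrow> F - G \<in> supported M"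
  using keys_diff by (fastforce simp: supported_def)

lemma supported_sum: "(\<And>i. i \<in> I \<Longrightarrow> f i \<in> supported M) \<Longrightarrow> sum f I \<in> supported M"
  by (induction I rule: infinite_finite_induct) (simp_all add: supported_add)

lemma supported_mono: "F \<in> supported M \<Longrightarrow> M \<subseteq> M' \<Longrightarrow> F \<in> supported M'"
  by (auto simp: supported_def)

lemma supported_mon: "e \<in> M \<Longrightarrow> mon e \<in> supported M"
  by (simp add: supported_def mon_def fps_const_def)

lemma supported_1: "submonoid M \<Longrightarrow> 1 \<in> supported M"
  using supported_mon[of 0 M] by (simp add: submonoid_def)

lemma supported_times:
  "submonoid M \<Longrightarrow> F \<in> supported M \<Longrightarrow> G \<in> supported M \<Longrightarrow> F * G \<in> supported M"
  by (rule supported_mult) (auto simp: submonoid_def)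

lemma supported_prod:
  "submonoid M \<Longrightarrow> (\<And>i. i \<in> I \<Longrightarrow> f i \<in> supported M) \<Longrightarrow> prod f I \<in> supported M"
  by (induction I rule: infinite_finite_induct) (simp_all add: supported_times supported_1)

lemma supported_power: "submonoid M \<Longrightarrow> F \<in> supported M \<Longrightarrow> F ^ n \<in> supported M"
  by (induction n) (simp_all add: supported_times supported_1)

lemma supported_of_nat: "submonoid M \<Longrightarrow> of_nat n \<in> supported M"
  by (induction n) (simp_all add: supported_add supported_1)

section \<open>Geometric series in elements of the ideal generated by q and t\<close>

definition small :: "lser \<Rightarrow> bool"
  where "small F \<longleftrightarrow> fps_nth (fps_nth F 0) 0 = 0"

lemma small_0 [simp]: "small 0"
  by (simp add: small_def)

lemma small_mult: "small F \<Longrightarrow> small (F * G)" "small G \<Longrightarrow> small (F * G)"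
  by (simp_all add: small_def)

lemma small_var: "small var_q" "small var_t"
  by (simp_all add: small_def var_q_def var_t_def)

definition iv :: "lser \<Rightarrow> lser"
  where "iv x = unit_inverse (1 - x)"

lemma small_unit: "small x \<Longrightarrow> 1 - x dvd 1"
  by (rule fps_unit_if_nth_0_unit, rule fps_unit_if_nth_0_unit) (simp add: small_def)

lemma iv_mult: "small x \<Longrightarrow> (1 - x) * iv x = 1"
  unfolding iv_def by (rule mult_unit_inverse[OF small_unit])

lemma iv_mult': "small x \<Longrightarrow> iv x * (1 - x) = 1"
  using iv_mult[of x] by (simp only: mult.commute)

lemma iv_eqI: "(1 - x) * y = 1 \<Longrightarrow> iv x = y"
  unfolding iv_def by (rule unit_inverse_eqI)

lemma iv_0 [simp]: "iv 0 = 1"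
  by (rule iv_eqI) simp

lemma iv_eq: "small x \<Longrightarrow> iv x = 1 + x * iv x"
  using iv_mult[of x] by (simp add: algebra_simps)

text \<open>Induction on the total degree: \<open>x\<close> having no constant coefficient, the recursion
  \<open>G = 1 + x * G\<close> for \<open>G = iv x\<close> expresses each coefficient through ones of smaller degree.\<close>

lemma supported_iv:
  assumes M: "submonoid M" and x: "x \<in> supported M" and "small x"
  shows "iv x \<in> supported M"
proof -
  have "keys (fps_nth (fps_nth (iv x) b) a) \<subseteq> M" if "a + b = n" for a b n
    using that
  proof (induction n arbitrary: a b rule: less_induct)
    case (less n)
    have 1: "keys (fps_nth (fps_nth x i) j * fps_nth (fps_nth (iv x) (b - i)) (a - j)) \<subseteq> M"
      if "i \<le> b" "j \<le> a" for i j
    proof (cases "i = 0 \<and> j = 0")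
      case True
      then show ?thesis using \<open>small x\<close> by (simp add: small_def)
    next
      case False
      then have "keys (fps_nth (fps_nth (iv x) (b - i)) (a - j)) \<subseteq> M"
        using that less.prems by (intro less.IH[OF _ refl]) auto
      moreover have "keys (fps_nth (fps_nth x i) j) \<subseteq> M"
        using x by (simp add: supported_def)
      ultimately show ?thesis
        using M keys_mult[of "fps_nth (fps_nth x i) j" "fps_nth (fps_nth (iv x) (b - i)) (a - j)"]
        unfolding submonoid_def by blast
    qed
    have "keys (fps_nth (fps_nth (x * iv x) b) a) \<subseteq> M"
      unfolding fps_mult_nth fps_sum_nth
      by (rule order.trans[OF keys_sum], rule UN_least, rule order.trans[OF keys_sum],
          rule UN_least, rule 1) auto
    moreover have "keys (fps_nth (fps_nth (1 :: lser) b) a) \<subseteq> M"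
      using supported_1[OF M] by (simp add: supported_def)
    ultimately show ?case
      using keys_add[of "fps_nth (fps_nth (1 :: lser) b) a" "fps_nth (fps_nth (x * iv x) b) a"]
      by (subst iv_eq[OF \<open>small x\<close>], unfold fps_add_nth) blast
  qed
  then show ?thesis by (simp add: supported_def)
qed

section \<open>Partial constant terms\<close>

definition free_of :: "nat set \<Rightarrow> (nat \<Rightarrow>\<^sub>0 int) set"
  where "free_of J = {e. \<forall>j\<in>J. lookup e j = 0}"

text \<open>Constant term in the variables with index in \<open>J\<close> only;
  \<open>ct UNIV\<close> is the full constant term. The value stays in \<open>lser\<close>, so that
  variables can be eliminated one after another.\<close>

definition ct :: "nat set \<Rightarrow> lser \<Rightarrow> lser"
  where "ct J = fps_map (fps_map (Poly_Mapping.mapp (\<lambda>k v. if k \<in> free_of J then v else 0)))"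

lemma lookup_ct:
  "lookup (fps_nth (fps_nth (ct J F) b) a) k =
     (if k \<in> free_of J then lookup (fps_nth (fps_nth F b) a) k else 0)"
  by (auto simp: ct_def lookup_mapp when_def in_keys_iff)

lemma submonoid_free_of: "submonoid (free_of J)"
  by (auto simp: submonoid_def free_of_def lookup_add)

lemma free_of_UNIV: "free_of UNIV = {0}"
  by (auto simp: free_of_def intro!: poly_mapping_eqI)

lemma ct_add: "ct J (F + G) = ct J F + ct J G"
  by (rule lser_eqI) (simp add: lookup_ct lookup_add)

lemma ct_diff: "ct J (F - G) = ct J F - ct J G"
  by (rule lser_eqI) (simp add: lookup_ct lookup_minus)

lemma ct_0 [simp]: "ct J 0 = 0"
  by (rule lser_eqI) (simp add: lookup_ct)

lemma ct_sum: "ct J (sum f A) = (\<Sum>x\<in>A. ct J (f x))"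
  by (induction A rule: infinite_finite_induct) (simp_all add: ct_add)

lemma ct_ct: "ct J (ct J' F) = ct (J \<union> J') F"
  by (rule lser_eqI) (auto simp: lookup_ct free_of_def)

lemma ct_UNIV_ct: "ct UNIV (ct J F) = ct UNIV F"
  by (simp add: ct_ct)

lemma ct_supported: "ct J F \<in> supported (free_of J)"
  by (auto simp: supported_def in_keys_iff lookup_ct split: if_splits)

lemma ct_id: "F \<in> supported (free_of J) \<Longrightarrow> ct J F = F"
  by (rule lser_eqI) (simp add: lookup_ct supported_lookup)

lemma ct_eq_0: "F \<in> supported (- free_of J) \<Longrightarrow> ct J F = 0"
  by (rule lser_eqI) (simp add: lookup_ct supported_lookup)

text \<open>Monomials of \<open>F\<close> do not change exponents at indices in \<open>J\<close>, so
  \<open>F\<close> times the discarded part \<open>G - ct J G\<close> is discarded again.\<close>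

lemma ct_mult:
  assumes F: "F \<in> supported (free_of J)"
  shows "ct J (F * G) = F * ct J G"
proof -
  have "G - ct J G \<in> supported (- free_of J)"
    by (auto simp: supported_def in_keys_iff lookup_ct lookup_minus split: if_splits)
  then have "F * (G - ct J G) \<in> supported (- free_of J)"
    by (rule supported_mult[OF F]) (auto simp: free_of_def lookup_add)
  then have "ct J (F * (G - ct J G)) = 0"
    by (rule ct_eq_0)
  moreover have "ct J (F * ct J G) = F * ct J G"
    by (intro ct_id supported_times submonoid_free_of F ct_supported)
  ultimately show ?thesis
    by (simp add: algebra_simps ct_diff)
qed

lemma ct_mult': "F \<in> supported (free_of J) \<Longrightarrow> ct J (G * F) = ct J G * F"
  using ct_mult[of F J G] by (simp add: mult.commute)

section \<open>Renaming of variables\<close>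

text \<open>\<open>map_key\<close> acts by pullback. Applied once to indices and once to exponent
  vectors, the two reversals cancel and u_i goes to u_(p i); see \<open>rename_vr\<close>.\<close>

definition rename :: "(nat \<Rightarrow> nat) \<Rightarrow> lser \<Rightarrow> lser"
  where "rename p = fps_map (fps_map (Poly_Mapping.map_key (Poly_Mapping.map_key p)))"

lemma lookup_map_key: "inj f \<Longrightarrow> lookup (Poly_Mapping.map_key f p) k = lookup p (f k)"
  by (simp add: map_key.rep_eq)

lemma bij_map_key:
  assumes "bij p"
  shows "bij (Poly_Mapping.map_key p :: ('a \<Rightarrow>\<^sub>0 'b::comm_monoid_add) \<Rightarrow> _)"
proof (rule o_bij)
  have "inj p" "inj (inv p)"
    using assms by (auto simp: bij_is_inj bij_imp_bij_inv)
  then show "Poly_Mapping.map_key (inv p) \<circ> Poly_Mapping.map_key p = id" "Poly_Mapping.map_key p \<circ> Poly_Mapping.map_key (inv p) = id"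
    using assms by (auto simp: fun_eq_iff lookup_map_key bij_is_surj surj_f_inv_f intro!: poly_mapping_eqI)
qed

lemma poly_mapping_sum_single: "p = (\<Sum>k\<in>keys p. Poly_Mapping.single k (lookup p k))"
  by (rule poly_mapping_eqI) (auto simp: lookup_sum lookup_single when_def in_keys_iff sum.delta')

text \<open>Multiplication is convolution, which an additive bijection respects. Decomposing both
  factors into monomials reduces the claim to additivity of \<open>inv f\<close>.\<close>

lemma unital_ring_hom_map_key:
  fixes f :: "'a::comm_monoid_add \<Rightarrow> 'a"
  assumes f: "bij f" and add: "\<And>a b. f (a + b) = f a + f b"
  shows "unital_ring_hom (Poly_Mapping.map_key f :: ('a \<Rightarrow>\<^sub>0 'b::comm_ring_1) \<Rightarrow> _)"
proof
  have inj: "inj f" using f by (rule bij_is_inj)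
  have f_inv: "f (inv f k) = k" for k
    using f by (simp add: bij_is_surj surj_f_inv_f)
  have single: "Poly_Mapping.map_key f (Poly_Mapping.single k v) = Poly_Mapping.single (inv f k) v" for k and v :: 'b
    using map_key_single[OF inj, of "inv f k" v] by (simp add: f_inv)
  have inv_add: "inv f (a + b) = inv f a + inv f b" for a b
    by (metis add f_inv inj inv_f_f)
  have mk_sum: "Poly_Mapping.map_key f (sum g A) = (\<Sum>x\<in>A. Poly_Mapping.map_key f (g x))" for g :: "'c \<Rightarrow> 'a \<Rightarrow>\<^sub>0 'b" and A
    by (induction A rule: infinite_finite_induct) (simp_all add: map_key_plus[OF inj] map_key_zero[OF inj])
  show "Poly_Mapping.map_key f (1 :: 'a \<Rightarrow>\<^sub>0 'b) = 1"
  proof -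
    have "f 0 = 0"
      by (metis add.right_neutral add add.left_neutral f_inv)
    then have "inv f 0 = 0" by (metis inj inv_f_f)
    then show ?thesis using single[of 0 1] by simp
  qed
  show "Poly_Mapping.map_key f (x + y) = Poly_Mapping.map_key f x + Poly_Mapping.map_key f y" for x y :: "'a \<Rightarrow>\<^sub>0 'b"
    by (rule map_key_plus[OF inj])
  show "Poly_Mapping.map_key f (x * y) = Poly_Mapping.map_key f x * Poly_Mapping.map_key f y" for x y :: "'a \<Rightarrow>\<^sub>0 'b"
    by (subst (1 2) poly_mapping_sum_single[of x], subst (1 2) poly_mapping_sum_single[of y])
      (simp add: sum_product mk_sum mult_single single inv_add)
qed

context
  fixes p :: "nat \<Rightarrow> nat"
  assumes p: "bij p"
begin

lemma unital_ring_hom_rename: "unital_ring_hom (rename p)"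
  unfolding rename_def
  by (intro unital_ring_hom_fps_map unital_ring_hom_map_key bij_map_key p map_key_plus bij_is_inj)

lemmas rename_simps = unital_ring_hom_simps[OF unital_ring_hom_rename]

lemma lookup_rename:
  "lookup (fps_nth (fps_nth (rename p F) b) a) k = lookup (fps_nth (fps_nth F b) a) (Poly_Mapping.map_key p k)"
  by (simp add: rename_def lookup_map_key bij_is_inj bij_map_key p)

lemma rename_mon: "rename p (mon (Poly_Mapping.map_key p e)) = mon e"
  by (rule lser_eqI)
    (simp add: lookup_rename mon_def lookup_single when_def fps_const_def
      inj_eq[OF bij_is_inj[OF bij_map_key[OF p]]])

lemma map_key_rename_single:
  "Poly_Mapping.map_key p (Poly_Mapping.single (p i) v) = Poly_Mapping.single i v"
  by (simp add: bij_is_inj p)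

lemma rename_iv: "small x \<Longrightarrow> rename p (iv x) = iv (rename p x)"
  by (metis iv_def iv_eqI iv_mult rename_simps(2) rename_simps(4) rename_simps(6))

lemma ct_UNIV_rename: "ct UNIV (rename p F) = ct UNIV F"
  by (rule lser_eqI) (auto simp: lookup_ct free_of_UNIV lookup_rename bij_is_inj[OF p])

end

lemma rename_scalar:
  assumes "bij p" "c \<in> supported {0}"
  shows "rename p c = c"
proof (rule lser_eqI)
  fix b a and k :: "nat \<Rightarrow>\<^sub>0 int"
  have "lookup (fps_nth (fps_nth c b) a) e = 0" if "e \<noteq> 0" for e
    using supported_lookup[OF assms(2)] that by simp
  moreover have "Poly_Mapping.map_key p k = 0 \<longleftrightarrow> k = 0"
    using inj_eq[OF bij_is_inj[OF bij_map_key[OF assms(1)]], of k 0]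
    by (simp add: bij_is_inj assms(1))
  ultimately show "lookup (fps_nth (fps_nth (rename p c) b) a) k = lookup (fps_nth (fps_nth c b) a) k"
    by (cases "k = 0") (simp_all add: lookup_rename assms(1))
qed

section \<open>Partial fractions without denominators\<close>

text \<open>Up to sign the square of the Vandermonde determinant. It is the common denominator of
  the partial fractions below, kept as a factor because the differences need not be
  invertible.\<close>

definition sq_vandermonde :: "('i \<Rightarrow> 'a::comm_ring_1) \<Rightarrow> 'i set \<Rightarrow> 'a"
  where "sq_vandermonde X I = (\<Prod>k\<in>I. \<Prod>l\<in>I - {k}. X k - X l)"

text \<open>\<open>sq_vandermonde X I\<close> times the coefficient c_i = (1 - t) prod_(l != i) (X_i
  - t X_l) / (X_i - X_l) in the expansion prod_i (w - t X_i) / (w - X_i) = t^|I| + sum_i c_i w / (w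
  - X_i).\<close>

definition pf_coeff :: "'a::comm_ring_1 \<Rightarrow> ('i \<Rightarrow> 'a) \<Rightarrow> 'i set \<Rightarrow> 'i \<Rightarrow> 'a"
  where "pf_coeff t X I i =
    (1 - t) * (\<Prod>l\<in>I - {i}. X i - t * X l) * (\<Prod>k\<in>I - {i}. \<Prod>l\<in>I - {k}. X k - X l)"

lemma pf_coeff_mult:
  assumes "finite I" "i \<in> I"
  shows "pf_coeff t X I i * (\<Prod>l\<in>I - {i}. X i - X l)
    = sq_vandermonde X I * ((1 - t) * (\<Prod>l\<in>I - {i}. X i - t * X l))"
  unfolding pf_coeff_def sq_vandermonde_def
  by (subst prod.remove[OF assms]) (simp add: mult_ac)

lemma monic_linear_prod:
  fixes a :: "'i \<Rightarrow> 'a::idom"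
  assumes "finite I"
  shows "degree (\<Prod>i\<in>I. [:- a i, 1:]) = card I" "coeff (\<Prod>i\<in>I. [:- a i, 1:]) (card I) = 1"
proof -
  have "degree (\<Prod>i\<in>I. [:- a i, 1:]) = card I \<and> coeff (\<Prod>i\<in>I. [:- a i, 1:]) (card I) = 1"
    using assms
  proof (induction I)
    case (insert i I)
    let ?p = "\<Prod>i\<in>I. [:- a i, 1:]"
    have "?p \<noteq> 0" by (auto simp: prod_zero_iff insert.hyps)
    then have "degree ([:- a i, 1:] * ?p) = Suc (card I)"
      using insert.IH by (subst degree_mult_eq) auto
    moreover have "lead_coeff ([:- a i, 1:] * ?p) = 1"
      using insert.IH by (subst lead_coeff_mult) auto
    ultimately show ?case using insert.hyps by simp
  qed simp
  then show "degree (\<Prod>i\<in>I. [:- a i, 1:]) = card I" "coeff (\<Prod>i\<in>I. [:- a i, 1:]) (card I) = 1"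
    by auto
qed

context
  fixes t :: "'a::idom" and X :: "'i \<Rightarrow> 'a" and I :: "'i set"
  assumes I: "finite I" "inj_on X I" and X0: "\<And>i. i \<in> I \<Longrightarrow> X i \<noteq> 0"
begin

lemma sq_vandermonde_nonzero: "sq_vandermonde X I \<noteq> 0"
  using I by (auto simp: sq_vandermonde_def prod_zero_iff inj_on_def)

text \<open>Both sides have degree at most |I| and agree at the |I| + 1 distinct points 0 and X_i;
  at X_i only the i-th summand of \<open>?R\<close> survives on the right.\<close>

lemma partial_fractions_poly:
  "smult (sq_vandermonde X I) (\<Prod>i\<in>I. [:- (t * X i), 1:]) =
   smult (sq_vandermonde X I * t ^ card I) (\<Prod>i\<in>I. [:- X i, 1:]) +
   (\<Sum>i\<in>I. smult (pf_coeff t X I i) (pCons 0 (\<Prod>l\<in>I - {i}. [:- X l, 1:])))"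
  (is "?P = ?Q + ?R")
proof (rule poly_eqI_degree)
  show "poly ?P x = poly (?Q + ?R) x" if x: "x \<in> insert 0 (X ` I)" for x
  proof (cases "x = 0")
    case True
    then show ?thesis
      by (simp add: poly_prod poly_sum prod.distrib prod_uminus)
  next
    case False
    then obtain i where i: "i \<in> I" "x = X i" using x by auto
    have 1: "(\<Prod>l\<in>I. X i - X l) = 0"
      using I i by auto
    have 2: "(\<Prod>l\<in>I - {k}. X i - X l) = 0" if "k \<in> I - {i}" for k
      using I i that by auto
    have "poly (?Q + ?R) x = (\<Sum>k\<in>I. pf_coeff t X I k * (X i * (\<Prod>l\<in>I - {k}. X i - X l)))"
      using 1 by (simp add: poly_prod poly_sum i mult.left_commute)
    also have "\<dots> = pf_coeff t X I i * (X i * (\<Prod>l\<in>I - {i}. X i - X l))"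
      using 2 by (subst sum.remove[OF I(1) i(1)]) simp
    also have "\<dots> = X i * (sq_vandermonde X I * ((1 - t) * (\<Prod>l\<in>I - {i}. X i - t * X l)))"
      unfolding pf_coeff_mult[OF I(1) i(1), of t X, symmetric] by (simp only: mult_ac)
    also have "\<dots> = sq_vandermonde X I * (\<Prod>l\<in>I. X i - t * X l)"
      by (subst prod.remove[OF I(1) i(1)], simp only: algebra_simps mult_1_left)
    also have "\<dots> = poly ?P x"
      by (simp add: poly_prod i)
    finally show ?thesis by simp
  qed
  have card: "card (insert 0 (X ` I)) = Suc (card I)"
    using I X0 by (subst card_insert_disjoint) (auto simp: card_image)
  have "degree ?P \<le> card I"
    by (rule order.trans[OF degree_smult_le])
      (simp only: monic_linear_prod(1)[OF I(1), of "\<lambda>i. t * X i"] order_refl)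
  then show "card (insert 0 (X ` I)) > degree ?P"
    by (simp only: card less_Suc_eq_le)
  have "degree ?Q \<le> card I"
    by (rule order.trans[OF degree_smult_le])
      (simp only: monic_linear_prod(1)[OF I(1), of X] order_refl)
  moreover have "degree ?R \<le> card I"
  proof (rule degree_sum_le[OF I(1)])
    fix i assume i: "i \<in> I"
    have "degree (\<Prod>l\<in>I - {i}. [:- X l, 1:]) = card (I - {i})"
      using I(1) by (intro monic_linear_prod) simp
    then have "degree (pCons 0 (\<Prod>l\<in>I - {i}. [:- X l, 1:])) \<le> Suc (card (I - {i}))"
      using degree_pCons_le[of 0 "\<Prod>l\<in>I - {i}. [:- X l, 1:]"] by (simp only:)
    also have "\<dots> = card I"
      by (rule card_Suc_Diff1[OF I(1) i])
    finally show "degree (smult (pf_coeff t X I i) (pCons 0 (\<Prod>l\<in>I - {i}. [:- X l, 1:]))) \<le> card I"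
      by (rule order.trans[OF degree_smult_le])
  qed
  ultimately have "degree (?Q + ?R) \<le> card I"
    by (rule degree_add_le)
  then show "card (insert 0 (X ` I)) > degree (?Q + ?R)"
    by (simp only: card less_Suc_eq_le)
qed

lemma partial_fractions:
  "sq_vandermonde X I * (\<Prod>i\<in>I. w - t * X i) =
   sq_vandermonde X I * t ^ card I * (\<Prod>i\<in>I. w - X i) +
   (\<Sum>i\<in>I. pf_coeff t X I i * (w * (\<Prod>l\<in>I - {i}. w - X l)))"
  using arg_cong[OF partial_fractions_poly, of "\<lambda>p. poly p w"]
  by (simp add: poly_prod poly_sum mult.left_commute)

text \<open>Compares the coefficients of w^|I| in \<open>partial_fractions_poly\<close>, all
  products of linear factors being monic.\<close>

lemma sum_pf_coeff: "(\<Sum>i\<in>I. pf_coeff t X I i) = sq_vandermonde X I * (1 - t ^ card I)"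
proof -
  have 1: "coeff (pCons 0 (\<Prod>l\<in>I - {i}. [:- X l, 1:])) (card I) = 1" if "i \<in> I" for i
  proof -
    have "card I = Suc (card (I - {i}))"
      by (rule card_Suc_Diff1[OF I(1) that, symmetric])
    then show ?thesis
      using monic_linear_prod(2)[of "I - {i}" X] I by (simp add: coeff_pCons)
  qed
  have "sq_vandermonde X I = sq_vandermonde X I * t ^ card I + (\<Sum>i\<in>I. pf_coeff t X I i)"
    using arg_cong[OF partial_fractions_poly, of "\<lambda>p. coeff p (card I)"]
    by (simp only: coeff_add coeff_smult coeff_sum monic_linear_prod(2)[OF I(1), of X]
        monic_linear_prod(2)[OF I(1), of "\<lambda>i. t * X i"] 1 mult_1_right cong: sum.cong)
  then show ?thesis by (simp add: right_diff_distrib eq_diff_eq add.commute)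
qed

end

section \<open>Constant terms as residues\<close>

definition vr :: "nat \<Rightarrow> lser"
  where "vr i = mon (Poly_Mapping.single i 1)"

definition vi :: "nat \<Rightarrow> lser"
  where "vi i = mon (- Poly_Mapping.single i 1)"

lemma vr_vi [simp]: "vr i * vi i = 1" "vi i * vr i = 1"
  by (simp_all add: vr_def vi_def)

lemma vr_vi_assoc [simp]: "vr i * (vi i * x) = x" "vi i * (vr i * x) = x"
  by (simp_all flip: mult.assoc)

lemma mon_diff: "mon (Poly_Mapping.single i 1 - Poly_Mapping.single j 1) = vr i * vi j"
  by (simp add: vr_def vi_def flip: mon_add)

lemma vr_neq_0: "vr i \<noteq> 0"
  using vr_vi(1)[of i] by force

lemma inj_vr: "inj vr"
proof (rule injI)
  fix i j assume "vr i = vr j"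
  then have "fps_nth (fps_nth (vr i) 0) 0 = fps_nth (fps_nth (vr j) 0) 0"
    by simp
  then show "i = j"
    by (simp add: vr_def mon_def frag_of_eq)
qed

lemma vr_supported: "i \<notin> J \<Longrightarrow> vr i \<in> supported (free_of J)"
  unfolding vr_def by (rule supported_mon) (auto simp: free_of_def lookup_single when_def)

lemma vi_supported: "i \<notin> J \<Longrightarrow> vi i \<in> supported (free_of J)"
  unfolding vi_def by (rule supported_mon) (auto simp: free_of_def lookup_single when_def)

definition nonneg_in :: "nat \<Rightarrow> (nat \<Rightarrow>\<^sub>0 int) set"
  where "nonneg_in j = {e. lookup e j \<ge> 0}"

lemma submonoid_nonneg_in: "submonoid (nonneg_in j)"
  by (auto simp: submonoid_def nonneg_in_def lookup_add)

lemma free_of_nonneg: "F \<in> supported (free_of {j}) \<Longrightarrow> F \<in> supported (nonneg_in j)"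
  by (erule supported_mono) (auto simp: free_of_def nonneg_in_def)

lemma vr_nonneg: "vr i \<in> supported (nonneg_in j)"
  unfolding vr_def by (rule supported_mon) (auto simp: nonneg_in_def lookup_single when_def)

lemma ct_vr_mult:
  assumes "p \<in> supported (nonneg_in j)"
  shows "ct {j} (vr j * p) = 0"
proof (rule ct_eq_0)
  have "vr j \<in> supported {e. lookup e j = 1}"
    unfolding vr_def by (rule supported_mon) simp
  then show "vr j * p \<in> supported (- free_of {j})"
    using assms by (rule supported_mult) (auto simp: nonneg_in_def free_of_def lookup_add)
qed

text \<open>\<open>ev j w g g'\<close> expresses that \<open>g\<close> contains no negative powers of \<open>u\<^sub>j\<close> and that \<open>g'\<close> is the
  result of substituting \<open>w\<close> for \<open>u\<^sub>j\<close> in \<open>g\<close>.\<close>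

definition ev :: "nat \<Rightarrow> lser \<Rightarrow> lser \<Rightarrow> lser \<Rightarrow> bool"
  where "ev j w g g' \<longleftrightarrow> g' \<in> supported (free_of {j}) \<and>
    (\<exists>p\<in>supported (nonneg_in j). g - g' = (vr j - w) * p)"

lemma ev_const: "g \<in> supported (free_of {j}) \<Longrightarrow> ev j w g g"
  unfolding ev_def by (intro conjI bexI[of _ 0]) auto

text \<open>For w = 0 the difference of \<open>g\<close> and \<open>g'\<close> is u_j times a series
  without negative powers of u_j, which has no constant term in u_j.\<close>

lemma ct_ev_0:
  assumes "ev j 0 g g'"
  shows "ct {j} g = g'"
proof -
  obtain p where "g' \<in> supported (free_of {j})" "p \<in> supported (nonneg_in j)" "g - g' = vr j * p"
    using assms by (auto simp: ev_def)
  then have "ct {j} (g - g') = 0" "ct {j} g' = g'"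
    by (simp_all add: ct_vr_mult ct_id)
  then show ?thesis by (simp add: ct_diff)
qed

context
  fixes j :: nat and w :: lser
  assumes w: "w \<in> supported (free_of {j})"
begin

lemma ev_vr: "ev j w (vr j) w"
  unfolding ev_def
  by (intro conjI bexI[of _ 1]) (simp_all add: w supported_1 submonoid_nonneg_in)

lemma ev_nonneg:
  assumes "ev j w g g'"
  shows "g \<in> supported (nonneg_in j)"
proof -
  obtain p where p: "g' \<in> supported (free_of {j})" "p \<in> supported (nonneg_in j)" "g - g' = (vr j - w) * p"
    using assms by (auto simp: ev_def)
  have "g' + (vr j - w) * p \<in> supported (nonneg_in j)"
    by (intro supported_add supported_times supported_diff submonoid_nonneg_in p vr_nonneg
        free_of_nonneg w)
  also have "g' + (vr j - w) * p = g"
    by (simp flip: p(3))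
  finally show ?thesis .
qed

lemma ev_add:
  assumes "ev j w g g'" "ev j w h h'"
  shows "ev j w (g + h) (g' + h')"
proof -
  obtain p r where p: "g' \<in> supported (free_of {j})" "p \<in> supported (nonneg_in j)" "g - g' = (vr j - w) * p"
    and r: "h' \<in> supported (free_of {j})" "r \<in> supported (nonneg_in j)" "h - h' = (vr j - w) * r"
    using assms by (auto simp: ev_def)
  have "g + h - (g' + h') = (g - g') + (h - h')"
    by simp
  also have "\<dots> = (vr j - w) * (p + r)"
    by (simp only: p(3) r(3) distrib_left)
  finally show ?thesis
    unfolding ev_def by (intro conjI bexI[of _ "p + r"] supported_add p r)
qed

lemma ev_diff:
  assumes "ev j w g g'" "ev j w h h'"
  shows "ev j w (g - h) (g' - h')"
proof -
  obtain p r where p: "g' \<in> supported (free_of {j})" "p \<in> supported (nonneg_in j)" "g - g' = (vr j - w) * p"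
    and r: "h' \<in> supported (free_of {j})" "r \<in> supported (nonneg_in j)" "h - h' = (vr j - w) * r"
    using assms by (auto simp: ev_def)
  have "g - h - (g' - h') = (g - g') - (h - h')"
    by simp
  also have "\<dots> = (vr j - w) * (p - r)"
    by (simp only: p(3) r(3) right_diff_distrib)
  finally show ?thesis
    unfolding ev_def by (intro conjI bexI[of _ "p - r"] supported_diff p r)
qed

lemma ev_mult:
  assumes g: "ev j w g g'" and h: "ev j w h h'"
  shows "ev j w (g * h) (g' * h')"
proof -
  obtain p r where p: "g' \<in> supported (free_of {j})" "p \<in> supported (nonneg_in j)" "g - g' = (vr j - w) * p"
    and r: "h' \<in> supported (free_of {j})" "r \<in> supported (nonneg_in j)" "h - h' = (vr j - w) * r"
    using assms by (auto simp: ev_def)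
  have "g * h - g' * h' = g * (h - h') + h' * (g - g')"
    by (simp add: algebra_simps)
  also have "\<dots> = (vr j - w) * (g * r + h' * p)"
    by (simp add: p(3) r(3) algebra_simps)
  finally show ?thesis
    unfolding ev_def
    by (intro conjI bexI[of _ "g * r + h' * p"] supported_add supported_times submonoid_nonneg_in
        submonoid_free_of p r ev_nonneg[OF g] free_of_nonneg)
qed

lemma ev_sum: "(\<And>i. i \<in> I \<Longrightarrow> ev j w (f i) (f' i)) \<Longrightarrow> ev j w (sum f I) (sum f' I)"
  by (induction I rule: infinite_finite_induct) (simp_all add: ev_add ev_const)

lemma ev_prod: "(\<And>i. i \<in> I \<Longrightarrow> ev j w (f i) (f' i)) \<Longrightarrow> ev j w (prod f I) (prod f' I)"
  by (induction I rule: infinite_finite_induct)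
    (simp_all add: ev_mult ev_const supported_1 submonoid_free_of)

lemma ev_iv:
  assumes g: "ev j w g g'" and small: "small g" "small g'"
  shows "ev j w (iv g) (iv g')"
proof -
  obtain p where p: "g' \<in> supported (free_of {j})" "p \<in> supported (nonneg_in j)" "g - g' = (vr j - w) * p"
    using assms by (auto simp: ev_def)
  have 1: "iv g' \<in> supported (free_of {j})" "iv g \<in> supported (nonneg_in j)"
    by (intro supported_iv submonoid_free_of submonoid_nonneg_in p small ev_nonneg[OF g])+
  have "iv g - iv g' = iv g * iv g' * (g - g')"
  proof -
    have "iv g * iv g' * (g - g') = iv g * (iv g' * (1 - g')) - iv g' * (iv g * (1 - g))"
      by (simp add: algebra_simps)
    then show ?thesis by (simp only: iv_mult' small mult_1_right)
  qed
  also have "\<dots> = (vr j - w) * (iv g * iv g' * p)"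
    by (simp add: p(3) mult_ac)
  finally show ?thesis
    unfolding ev_def
    by (intro conjI bexI[of _ "iv g * iv g' * p"] supported_times submonoid_nonneg_in 1
        free_of_nonneg p)
qed

text \<open>Apart from 1, the geometric series in w / u_j has only negative powers of u_j, so its
  product with \<open>g'\<close> has constant term \<open>g'\<close>. The remainder
  \<open>g - g'\<close> contains the factor u_j - w = u_j (1 - w / u_j), which cancels the series
  and leaves only positive powers of u_j.\<close>

lemma ct_residue:
  assumes "small w" and g: "ev j w g g'"
  shows "ct {j} (iv (w * vi j) * g) = g'"
proof -
  obtain p where p: "g' \<in> supported (free_of {j})" "p \<in> supported (nonneg_in j)" "g - g' = (vr j - w) * p"
    using assms by (auto simp: ev_def)
  define M where "M = {e :: nat \<Rightarrow>\<^sub>0 int. lookup e j \<le> 0}"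
  have M: "submonoid M" by (auto simp: M_def submonoid_def lookup_add)
  have small: "small (w * vi j)" using \<open>small w\<close> by (rule small_mult)
  have wv: "w * vi j \<in> supported {e. lookup e j = -1}"
    unfolding vi_def by (rule supported_mult[OF w supported_mon[of _ "{e. lookup e j = -1}"]])
      (auto simp: free_of_def lookup_add)
  have ivM: "iv (w * vi j) \<in> supported M"
    by (rule supported_iv[OF M supported_mono[OF wv] small]) (auto simp: M_def)
  have "w * vi j * iv (w * vi j) \<in> supported (- free_of {j})"
    by (rule supported_mult[OF wv ivM]) (auto simp: M_def free_of_def lookup_add)
  then have "ct {j} (iv (w * vi j)) = ct {j} 1"
    by (subst iv_eq[OF small]) (simp only: ct_add ct_eq_0 add_0_right)
  also have "\<dots> = 1"
    by (simp add: ct_id supported_1 submonoid_free_of)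
  finally have 1: "ct {j} (iv (w * vi j) * g') = g'"
    by (simp add: ct_mult' p)
  have "iv (w * vi j) * (vr j - w) = iv (w * vi j) * (1 - w * vi j) * vr j"
    by (simp add: algebra_simps)
  then have 2: "iv (w * vi j) * (vr j - w) = vr j"
    by (simp only: iv_mult'[OF small] mult_1)
  have "iv (w * vi j) * g = iv (w * vi j) * g' + iv (w * vi j) * (vr j - w) * p"
    unfolding mult.assoc by (simp flip: p(3) distrib_left)
  then have "ct {j} (iv (w * vi j) * g) = ct {j} (iv (w * vi j) * g') + ct {j} (vr j * p)"
    by (simp only: 2 ct_add)
  then show ?thesis
    by (simp only: 1 ct_vr_mult[OF p(2)] add_0_right)
qed

end

text \<open>Partial fractions at w = u_j turn the product into t^|I| + sum_i c_i / (1 - X_i / u_j);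
  the constant term then evaluates \<open>g\<close> at 0 and at each X_i. The factor
  \<open>sq_vandermonde X I\<close> clears the denominators of the c_i.\<close>

lemma ct_partial_fractions:
  assumes I: "finite I" "inj_on X I"
    and X: "\<And>i. i \<in> I \<Longrightarrow> X i \<noteq> 0 \<and> small (X i) \<and> X i \<in> supported (free_of {j})"
    and t: "t \<in> supported (free_of {j})"
    and g0: "ev j 0 g g0" and gi: "\<And>i. i \<in> I \<Longrightarrow> ev j (X i) g (g' i)"
  shows "sq_vandermonde X I * ct {j} ((\<Prod>i\<in>I. (1 - t * X i * vi j) * iv (X i * vi j)) * g)
    = sq_vandermonde X I * t ^ card I * g0 + (\<Sum>i\<in>I. pf_coeff t X I i * g' i)"
proof -
  \<comment> \<open>\<open>?f i\<close> is the inverse of u_j - X_i, expanded in powers of X_i /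
    u_j.\<close>
  let ?V = "sq_vandermonde X I" and ?f = "\<lambda>i. vi j * iv (X i * vi j)"
  have small: "small (X i * vi j)" if "i \<in> I" for i
    using X that by (simp add: small_mult)
  have 1: "(vr j - X i) * ?f i = 1" if "i \<in> I" for i
  proof -
    have "(vr j - X i) * ?f i = (1 - X i * vi j) * iv (X i * vi j)"
      by (simp add: algebra_simps)
    then show ?thesis by (simp only: iv_mult[OF small[OF that]])
  qed
  have 2: "vr j * (\<Prod>l\<in>I - {i}. vr j - X l) * (\<Prod>i\<in>I. ?f i) = iv (X i * vi j)" if i: "i \<in> I" for i
  proof -
    have "vr j * (\<Prod>l\<in>I - {i}. vr j - X l) * (\<Prod>i\<in>I. ?f i) =
        vr j * ?f i * (\<Prod>l\<in>I - {i}. (vr j - X l) * ?f l)"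
      unfolding prod.distrib[of "\<lambda>l. vr j - X l"]
      by (subst prod.remove[OF I(1) i, of ?f]) (simp only: mult_ac)
    also have "(\<Prod>l\<in>I - {i}. (vr j - X l) * ?f l) = 1"
      by (rule prod.neutral, rule ballI, rule 1) simp
    finally show ?thesis by simp
  qed
  have 3: "(\<Prod>i\<in>I. vr j - X i) * (\<Prod>i\<in>I. ?f i) = 1"
    unfolding prod.distrib[symmetric] by (rule prod.neutral, rule ballI, rule 1)
  have "(1 - t * X i * vi j) * iv (X i * vi j) = (vr j - t * X i) * ?f i" for i
    by (simp add: algebra_simps)
  then have "?V * (\<Prod>i\<in>I. (1 - t * X i * vi j) * iv (X i * vi j)) =
      ?V * (\<Prod>i\<in>I. vr j - t * X i) * (\<Prod>i\<in>I. ?f i)"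
    by (simp only: prod.distrib mult.assoc)
  also have "\<dots> = (?V * t ^ card I * (\<Prod>i\<in>I. vr j - X i) +
      (\<Sum>i\<in>I. pf_coeff t X I i * (vr j * (\<Prod>l\<in>I - {i}. vr j - X l)))) * (\<Prod>i\<in>I. ?f i)"
    using X by (subst partial_fractions[OF I]) auto
  also have "\<dots> = ?V * t ^ card I * ((\<Prod>i\<in>I. vr j - X i) * (\<Prod>i\<in>I. ?f i)) +
      (\<Sum>i\<in>I. pf_coeff t X I i * (vr j * (\<Prod>l\<in>I - {i}. vr j - X l) * (\<Prod>i\<in>I. ?f i)))"
    by (simp only: distrib_right sum_distrib_right mult.assoc)
  also have "\<dots> = ?V * t ^ card I + (\<Sum>i\<in>I. pf_coeff t X I i * iv (X i * vi j))"
    by (simp only: 3 mult_1_right, rule arg_cong[where f = "\<lambda>x. _ + x"],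
        rule sum.cong[OF refl], simp only: 2)
  finally have 4: "?V * ((\<Prod>i\<in>I. (1 - t * X i * vi j) * iv (X i * vi j)) * g) =
      ?V * t ^ card I * g + (\<Sum>i\<in>I. pf_coeff t X I i * (iv (X i * vi j) * g))"
    by (simp only: mult.assoc[symmetric] distrib_right sum_distrib_right)
  have V: "?V \<in> supported (free_of {j})"
    unfolding sq_vandermonde_def using X
    by (intro supported_prod supported_diff submonoid_free_of) auto
  have C: "pf_coeff t X I i \<in> supported (free_of {j})" if "i \<in> I" for i
    unfolding pf_coeff_def using X that t
    by (intro supported_prod supported_diff supported_times supported_1 submonoid_free_of) auto
  have "ct {j} (?V * ((\<Prod>i\<in>I. (1 - t * X i * vi j) * iv (X i * vi j)) * g)) =
      ?V * t ^ card I * ct {j} g + (\<Sum>i\<in>I. pf_coeff t X I i * ct {j} (iv (X i * vi j) * g))"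
    unfolding 4 ct_add ct_sum
    using ct_mult[OF C] ct_mult[OF supported_times[OF submonoid_free_of V supported_power[OF submonoid_free_of t]]]
    by simp
  also have "ct {j} g = g0"
    using g0 by (rule ct_ev_0)
  also have "(\<Sum>i\<in>I. pf_coeff t X I i * ct {j} (iv (X i * vi j) * g)) = (\<Sum>i\<in>I. pf_coeff t X I i * g' i)"
    using X gi by (intro sum.cong refl) (simp add: ct_residue)
  finally show ?thesis by (simp only: ct_mult[OF V])
qed

section \<open>Symmetrization of the Hall--Littlewood weight\<close>

definition hl_factor :: "lser \<Rightarrow> lser \<Rightarrow> lser"
  where "hl_factor t z = (1 - z) * iv (t * z)"

definition hl_sym_weight :: "lser \<Rightarrow> nat set \<Rightarrow> lser"
  where "hl_sym_weight t Y = (\<Prod>k\<in>Y. \<Prod>l\<in>Y - {k}. hl_factor t (vr l * vi k))"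

text \<open>The triangular weight. The list fixes the order of elimination: the factors belonging to
  the head u_j are series in u_j / u_l and contain it in nonnegative powers only.\<close>

fun hl_weight :: "lser \<Rightarrow> nat list \<Rightarrow> lser"
  where "hl_weight t [] = 1"
  | "hl_weight t (j # ys) = (\<Prod>l\<in>set ys. hl_factor t (vr j * vi l)) * hl_weight t ys"

abbreviation scalar :: "lser \<Rightarrow> bool"
  where "scalar c \<equiv> c \<in> supported {0}"

lemma submonoid_0: "submonoid {0}"
  by (simp add: submonoid_def)

lemma scalar_supported: "scalar c \<Longrightarrow> c \<in> supported (free_of J)"
  by (erule supported_mono) (simp add: free_of_def)

lemma scalar_ct: "scalar c \<Longrightarrow> ct J (c * F) = c * ct J F"
  by (simp add: ct_mult scalar_supported)

lemma supported_hl_factor: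
  "submonoid M \<Longrightarrow> t \<in> supported M \<Longrightarrow> z \<in> supported M \<Longrightarrow> small t \<Longrightarrow> hl_factor t z \<in> supported M"
  unfolding hl_factor_def
  by (intro supported_times supported_diff supported_iv supported_1 small_mult)

lemma supported_hl_weight:
  assumes "scalar t" "small t" "set ys \<inter> J = {}"
  shows "hl_weight t ys \<in> supported (free_of J)"
  using assms(3) scalar_supported[OF assms(1), of J] assms(2)
  by (induction ys)
    (auto intro!: supported_times supported_prod supported_hl_factor supported_1 submonoid_free_of
      vr_supported vi_supported)

lemma rename_vr:
  assumes "bij p"
  shows "rename p (vr i) = vr (p i)"
  using rename_mon[OF assms, of "Poly_Mapping.single (p i) 1"]
  by (simp add: vr_def map_key_rename_single assms)

lemma rename_vi:
  assumes "bij p"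
  shows "rename p (vi i) = vi (p i)"
  using rename_mon[OF assms, of "Poly_Mapping.single (p i) (- 1)"]
  by (simp add: vi_def map_key_rename_single assms flip: single_uminus)

text \<open>Intermediate between the symmetric and the triangular weight: only u_i has been ordered
  in front of the others.\<close>

definition peeled_weight :: "lser \<Rightarrow> nat set \<Rightarrow> nat \<Rightarrow> lser"
  where "peeled_weight t Y i = (\<Prod>k\<in>Y - {i}. hl_factor t (vr i * vi k)) * hl_sym_weight t (Y - {i})"

definition symmetric_in :: "nat set \<Rightarrow> lser \<Rightarrow> bool"
  where "symmetric_in Y S \<longleftrightarrow> (\<forall>a\<in>Y. \<forall>b\<in>Y. rename (transpose a b) S = S)"

context
  fixes t :: lser
  assumes t: "scalar t" "small t"
begin

lemma rename_hl_factor: "bij p \<Longrightarrow> rename p (hl_factor t z) = hl_factor t (rename p z)"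
  by (simp add: hl_factor_def rename_simps rename_iv small_mult t rename_scalar)

lemma rename_hl_sym_weight:
  assumes p: "bij p"
  shows "rename p (hl_sym_weight t Y) = hl_sym_weight t (p ` Y)"
proof -
  have inj: "inj_on p A" for A
    using p by (meson bij_is_inj inj_on_subset subset_UNIV)
  have "p ` Y - {p k} = p ` (Y - {k})" for k
    using p by (auto simp: bij_is_inj inj_eq)
  then have "hl_sym_weight t (p ` Y) = (\<Prod>k\<in>Y. \<Prod>l\<in>Y - {k}. hl_factor t (vr (p l) * vi (p k)))"
    by (simp add: hl_sym_weight_def prod.reindex[OF inj])
  then show ?thesis
    by (simp add: hl_sym_weight_def rename_simps[OF p] rename_hl_factor[OF p] rename_vr[OF p] rename_vi[OF p])
qed

lemma rename_peeled_weight: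
  assumes p: "bij p"
  shows "rename p (peeled_weight t Y i) = peeled_weight t (p ` Y) (p i)"
proof -
  have inj: "inj_on p A" for A
    using p by (meson bij_is_inj inj_on_subset subset_UNIV)
  have "p ` Y - {p i} = p ` (Y - {i})"
    using p by (auto simp: bij_is_inj inj_eq)
  then show ?thesis
    by (simp add: peeled_weight_def rename_simps[OF p] rename_hl_factor[OF p] rename_vr[OF p]
        rename_vi[OF p] rename_hl_sym_weight[OF p] prod.reindex[OF inj])
qed

text \<open>By \<open>sum_pf_coeff\<close> for X_i = u_i, the sum over i of prod_(l != i) (u_i - t
  u_l) / (u_i - u_l) is (1 - t^|Y|) / (1 - t). Multiplied by the symmetric weight, the i-th summand
  loses the factors in u_l / u_i and becomes the peeled weight.\<close>

lemma sum_peeled_weight: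
  assumes Y: "finite Y"
  shows "(1 - t) * (\<Sum>i\<in>Y. peeled_weight t Y i) = (1 - t ^ card Y) * hl_sym_weight t Y"
proof -
  \<comment> \<open>\<open>f k l\<close> is the expansion of 1 / (u_k - t u_l), so \<open>M\<close>
    is the reciprocal of the common denominator of the symmetric weight.\<close>
  define f where "f = (\<lambda>k l. vi k * iv (t * (vr l * vi k)))"
  define M where "M = (\<Prod>k\<in>Y. \<Prod>l\<in>Y - {k}. f k l)"
  have small: "small (t * z)" for z
    using t(2) by (rule small_mult)
  have 1: "(vr k - vr l) * f k l = hl_factor t (vr l * vi k)" for k l
    by (simp add: f_def hl_factor_def algebra_simps)
  have 2: "(vr k - t * vr l) * f k l = 1" for k l
  proof -
    have "(vr k - t * vr l) * f k l = (1 - t * (vr l * vi k)) * iv (t * (vr l * vi k))"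
      by (simp add: f_def algebra_simps)
    then show ?thesis by (simp only: iv_mult[OF small])
  qed
  have V: "sq_vandermonde vr Y * M = hl_sym_weight t Y"
    unfolding sq_vandermonde_def M_def hl_sym_weight_def by (simp only: prod.distrib[symmetric] 1)
  have "pf_coeff t vr Y i * M = (1 - t) * peeled_weight t Y i" if i: "i \<in> Y" for i
  proof -
    have "pf_coeff t vr Y i * M = (1 - t) * (\<Prod>l\<in>Y - {i}. (vr i - t * vr l) * f i l) *
        (\<Prod>k\<in>Y - {i}. \<Prod>l\<in>Y - {k}. (vr k - vr l) * f k l)"
      unfolding pf_coeff_def M_def prod.remove[OF Y i, of "\<lambda>k. \<Prod>l\<in>Y - {k}. f k l"]
      by (simp only: prod.distrib mult_ac)
    also have "\<dots> = (1 - t) * (\<Prod>k\<in>Y - {i}. \<Prod>l\<in>Y - {k}. hl_factor t (vr l * vi k))"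
      by (simp only: 1 2 prod.neutral_const mult_1_right)
    also have "(\<Prod>k\<in>Y - {i}. \<Prod>l\<in>Y - {k}. hl_factor t (vr l * vi k)) =
        (\<Prod>k\<in>Y - {i}. hl_factor t (vr i * vi k) * (\<Prod>l\<in>Y - {i} - {k}. hl_factor t (vr l * vi k)))"
    proof (rule prod.cong[OF refl])
      fix k assume "k \<in> Y - {i}"
      moreover have "Y - {k} - {i} = Y - {i} - {k}" by auto
      ultimately show "(\<Prod>l\<in>Y - {k}. hl_factor t (vr l * vi k)) =
          hl_factor t (vr i * vi k) * (\<Prod>l\<in>Y - {i} - {k}. hl_factor t (vr l * vi k))"
        using Y i prod.remove[of "Y - {k}" i "\<lambda>l. hl_factor t (vr l * vi k)"] by auto
    qed
    also have "\<dots> = peeled_weight t Y i"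
      by (simp only: peeled_weight_def hl_sym_weight_def prod.distrib)
    finally show ?thesis .
  qed
  then have "(1 - t) * (\<Sum>i\<in>Y. peeled_weight t Y i) = (\<Sum>i\<in>Y. pf_coeff t vr Y i) * M"
    by (simp add: sum_distrib_left sum_distrib_right)
  also have "\<dots> = (1 - t ^ card Y) * (sq_vandermonde vr Y * M)"
    by (subst sum_pf_coeff) (auto simp: Y vr_neq_0 mult_ac intro: inj_on_subset[OF inj_vr])
  finally show ?thesis by (simp only: V)
qed

text \<open>One variable is peeled off at a time. By renaming, all summands in
  \<open>sum_peeled_weight\<close> have the same constant term against a symmetric \<open>S\<close>,
  so each step contributes the factor |Y| (1 - t) / (1 - t^|Y|).\<close>

lemma symmetrization:
  assumes "distinct ys" "symmetric_in (set ys) S"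
  shows "ct UNIV (S * hl_sym_weight t (set ys)) * q_pochhammer t t (length ys) =
    of_nat (fact (length ys)) * (1 - t) ^ length ys * ct UNIV (S * hl_weight t ys)"
  using assms
proof (induction ys arbitrary: S)
  case Nil
  then show ?case by (simp add: hl_sym_weight_def q_pochhammer_def)
next
  case (Cons j ys)
  let ?Y = "set (j # ys)" and ?n = "length ys"
  have Y: "?Y - {j} = set ys" "card ?Y = Suc ?n"
    using Cons.prems by (auto simp: distinct_card)
  \<comment> \<open>The factors of the peeled variable u_j are absorbed into the symmetric function;
    they are symmetric in the remaining variables, as the induction hypothesis requires.\<close>
  let ?S = "S * (\<Prod>k\<in>set ys. hl_factor t (vr j * vi k))"
  have eq: "ct UNIV (S * peeled_weight t ?Y i) = ct UNIV (?S * hl_sym_weight t (set ys))"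
    if i: "i \<in> ?Y" for i
  proof -
    have p: "bij (transpose j i)" by simp
    have "transpose j i ` ?Y = ?Y"
      using i by (intro transpose_image_eq) simp
    moreover have "rename (transpose j i) S = S"
      using bspec[OF bspec[OF Cons.prems(2)[unfolded symmetric_in_def], of j], OF _ i] by simp
    ultimately have "rename (transpose j i) (S * peeled_weight t ?Y j) = S * peeled_weight t ?Y i"
      by (simp only: rename_simps[OF p] rename_peeled_weight[OF p] transpose_apply_first)
    then have "ct UNIV (S * peeled_weight t ?Y i) = ct UNIV (S * peeled_weight t ?Y j)"
      using ct_UNIV_rename[OF p] by metis
    then show ?thesis
      by (simp only: peeled_weight_def Y mult.assoc)
  qed
  have sym: "symmetric_in (set ys) ?S"
    unfolding symmetric_in_def
  proof (intro ballI)
    fix a b assume ab: "a \<in> set ys" "b \<in> set ys"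
    let ?p = "transpose a b"
    have p: "bij ?p" by simp
    have "?p j = j" "?p ` set ys = set ys"
      using ab Cons.prems(1) by (auto intro!: transpose_image_eq transpose_apply_other)
    moreover have "(\<Prod>k\<in>?p ` set ys. hl_factor t (vr j * vi k)) = (\<Prod>k\<in>set ys. hl_factor t (vr j * vi (?p k)))"
      by (simp add: prod.reindex)
    ultimately show "rename ?p ?S = ?S"
      using Cons.prems(2) ab
      by (simp add: rename_simps[OF p] rename_hl_factor[OF p] rename_vr[OF p] rename_vi[OF p] symmetric_in_def)
  qed
  have sc: "scalar (1 - t)" "scalar (1 - t ^ Suc ?n)"
    by (intro supported_diff supported_1 supported_power submonoid_0 t)+
  have "ct UNIV (S * hl_sym_weight t ?Y) * (1 - t ^ Suc ?n) =
      ct UNIV (S * ((1 - t ^ card ?Y) * hl_sym_weight t ?Y))"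
    using scalar_ct[OF sc(2), of UNIV "S * hl_sym_weight t ?Y"] by (simp only: Y mult_ac)
  also have "\<dots> = ct UNIV (\<Sum>i\<in>?Y. (1 - t) * (S * peeled_weight t ?Y i))"
    unfolding sum_peeled_weight[OF finite_set, symmetric] by (simp only: sum_distrib_left mult_ac)
  also have "\<dots> = (\<Sum>i\<in>?Y. (1 - t) * ct UNIV (?S * hl_sym_weight t (set ys)))"
    unfolding ct_sum by (rule sum.cong[OF refl]) (simp only: scalar_ct sc eq)
  also have "\<dots> = of_nat (Suc ?n) * (1 - t) * ct UNIV (?S * hl_sym_weight t (set ys))"
    by (simp only: sum_constant Y mult.assoc)
  finally have *: "ct UNIV (S * hl_sym_weight t ?Y) * (1 - t ^ Suc ?n) =
      of_nat (Suc ?n) * (1 - t) * ct UNIV (?S * hl_sym_weight t (set ys))" .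
  have "ct UNIV (S * hl_sym_weight t ?Y) * q_pochhammer t t (Suc ?n) =
      ct UNIV (S * hl_sym_weight t ?Y) * (1 - t ^ Suc ?n) * q_pochhammer t t ?n"
    by (simp add: q_pochhammer_def mult_ac)
  also have "\<dots> = of_nat (Suc ?n) * (1 - t) *
      (ct UNIV (?S * hl_sym_weight t (set ys)) * q_pochhammer t t ?n)"
    by (simp only: * mult.assoc)
  also have "\<dots> = of_nat (Suc ?n) * (1 - t) * (of_nat (fact ?n) * (1 - t) ^ ?n *
      ct UNIV (?S * hl_weight t ys))"
    using Cons.IH[OF _ sym] Cons.prems(1) by simp
  also have "\<dots> = of_nat (fact (Suc ?n)) * (1 - t) ^ Suc ?n * ct UNIV (S * hl_weight t (j # ys))"
    by (simp only: fact_Suc of_nat_mult of_nat_id power_Suc hl_weight.simps mult_ac)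
  finally show ?case by simp
qed

end

section \<open>Sums over injections\<close>

definition inj_maps :: "'b set \<Rightarrow> 'c set \<Rightarrow> ('b \<Rightarrow> 'c) set"
  where "inj_maps B Y = {f \<in> B \<rightarrow>\<^sub>E Y. inj_on f B}"

text \<open>The permanent of the rectangular matrix \<open>f\<close>. For entries
  \<open>pos_powers s b (vr y)\<close> it is, up to scalars, a generating series of the monomial
  symmetric functions with exactly |B| positive parts.\<close>

definition inj_sum :: "('b \<Rightarrow> 'c \<Rightarrow> 'a::comm_semiring_1) \<Rightarrow> 'b set \<Rightarrow> 'c set \<Rightarrow> 'a"
  where "inj_sum f B Y = (\<Sum>\<sigma>\<in>inj_maps B Y. \<Prod>b\<in>B. f b (\<sigma> b))"

lemma finite_inj_maps: "finite B \<Longrightarrow> finite Y \<Longrightarrow> finite (inj_maps B Y)"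
  by (simp add: inj_maps_def finite_PiE)

lemma inj_sum_empty [simp]:
  fixes f :: "'b \<Rightarrow> 'c \<Rightarrow> 'a::comm_semiring_1"
  shows "inj_sum f {} Y = 1"
proof -
  have "inj_maps ({} :: 'b set) Y = {\<lambda>_. undefined}" by (auto simp: inj_maps_def)
  then show ?thesis by (simp add: inj_sum_def)
qed

lemma inj_sum_eq_0:
  assumes "finite Y" "card Y < card B"
  shows "inj_sum f B Y = 0"
proof -
  have "inj_maps B Y = {}"
    using assms card_inj_on_le[of _ B Y] by (fastforce simp: inj_maps_def)
  then show ?thesis by (simp add: inj_sum_def)
qed

lemma inj_maps_insert:
  assumes "j \<notin> Y"
  shows "inj_maps B (insert j Y) = inj_maps B Y \<union> (\<Union>b\<in>B. (\<lambda>\<sigma>. \<sigma>(b := j)) ` inj_maps (B - {b}) Y)"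
proof (intro set_eqI iffI)
  fix \<sigma> assume \<sigma>: "\<sigma> \<in> inj_maps B (insert j Y)"
  show "\<sigma> \<in> inj_maps B Y \<union> (\<Union>b\<in>B. (\<lambda>\<sigma>. \<sigma>(b := j)) ` inj_maps (B - {b}) Y)"
  proof (cases "j \<in> \<sigma> ` B")
    case False
    then show ?thesis using \<sigma> by (auto simp: inj_maps_def PiE_iff)
  next
    case True
    then obtain b where b: "b \<in> B" "\<sigma> b = j" by auto
    \<comment> \<open>The value \<open>undefined\<close> at \<open>b\<close> makes the restriction
      extensional on \<open>B - {b}\<close>.\<close>
    have "\<sigma>(b := undefined) \<in> inj_maps (B - {b}) Y"
      using \<sigma> b by (auto simp: inj_maps_def PiE_iff inj_on_def extensional_def)
    moreover have "\<sigma> = (\<sigma>(b := undefined))(b := j)" using b by auto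
    ultimately show ?thesis using b by blast
  qed
next
  fix \<sigma> assume "\<sigma> \<in> inj_maps B Y \<union> (\<Union>b\<in>B. (\<lambda>\<sigma>. \<sigma>(b := j)) ` inj_maps (B - {b}) Y)"
  then consider "\<sigma> \<in> inj_maps B Y" | b \<tau> where "b \<in> B" "\<tau> \<in> inj_maps (B - {b}) Y" "\<sigma> = \<tau>(b := j)"
    by blast
  then show "\<sigma> \<in> inj_maps B (insert j Y)"
  proof cases
    case 1
    then show ?thesis by (auto simp: inj_maps_def PiE_iff)
  next
    case 2
    have "\<sigma> \<in> B \<rightarrow>\<^sub>E insert j Y"
      using 2 by (auto simp: inj_maps_def PiE_iff extensional_def)
    moreover have "inj_on \<sigma> (insert b (B - {b}))"
      using 2 assms by (subst inj_on_insert) (auto simp: inj_maps_def PiE_iff inj_on_def)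
    ultimately show ?thesis
      using 2(1) by (simp add: inj_maps_def insert_absorb)
  qed
qed

text \<open>Expansion of a permanent along the column \<open>j\<close>: at most one row
  \<open>b\<close> uses it.\<close>

lemma inj_sum_insert:
  assumes B: "finite B" and Y: "finite Y" "j \<notin> Y"
  shows "inj_sum f B (insert j Y) = inj_sum f B Y + (\<Sum>b\<in>B. f b j * inj_sum f (B - {b}) Y)"
proof -
  let ?U = "\<lambda>b. (\<lambda>\<sigma>. \<sigma>(b := j)) ` inj_maps (B - {b}) Y" and ?F = "\<lambda>\<sigma>. \<Prod>b\<in>B. f b (\<sigma> b)"
  have U: "\<sigma> b = j \<and> (\<forall>b'\<in>B - {b}. \<sigma> b' \<noteq> j)" if "\<sigma> \<in> ?U b" for \<sigma> b
    using that Y(2) by (auto simp: inj_maps_def PiE_iff)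
  have inj: "inj_on (\<lambda>\<sigma>. \<sigma>(b := j)) (inj_maps (B - {b}) Y)" for b
  proof (rule inj_onI)
    fix \<sigma> \<tau> assume *: "\<sigma> \<in> inj_maps (B - {b}) Y" "\<tau> \<in> inj_maps (B - {b}) Y" "\<sigma>(b := j) = \<tau>(b := j)"
    then have "\<sigma> b = \<tau> b"
      by (auto simp: inj_maps_def PiE_iff extensional_def)
    then show "\<sigma> = \<tau>" using *(3) by (metis fun_upd_triv fun_upd_upd)
  qed
  have "inj_maps B Y \<inter> (\<Union>b\<in>B. ?U b) = {}"
    using Y(2) U by (fastforce simp: inj_maps_def PiE_iff)
  moreover have "?U b \<inter> ?U b' = {}" if "b \<in> B" "b' \<in> B" "b \<noteq> b'" for b b'
    using U that by blast
  ultimately have "inj_sum f B (insert j Y) = inj_sum f B Y + (\<Sum>b\<in>B. sum ?F (?U b))"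
    unfolding inj_sum_def inj_maps_insert[OF Y(2)] using B Y
    by (subst sum.union_disjoint) (auto simp: finite_inj_maps sum.UNION_disjoint)
  also have "(\<Sum>b\<in>B. sum ?F (?U b)) = (\<Sum>b\<in>B. f b j * inj_sum f (B - {b}) Y)"
  proof (rule sum.cong[OF refl])
    fix b assume b: "b \<in> B"
    have "?F (\<sigma>(b := j)) = f b j * (\<Prod>b'\<in>B - {b}. f b' (\<sigma> b'))" for \<sigma>
      by (subst prod.remove[OF B b]) (auto intro!: prod.cong)
    then show "sum ?F (?U b) = f b j * inj_sum f (B - {b}) Y"
      by (simp add: sum.reindex[OF inj] inj_sum_def sum_distrib_left)
  qed
  finally show ?thesis .
qed

section \<open>The reproducing kernel property\<close>

definition cauchy_factor :: "lser \<Rightarrow> lser \<Rightarrow> lser"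
  where "cauchy_factor t z = (1 - t * z) * iv z"

definition cauchy_kernel :: "lser \<Rightarrow> lser \<Rightarrow> nat set \<Rightarrow> nat set \<Rightarrow> lser"
  where "cauchy_kernel q t X Y = (\<Prod>i\<in>X. \<Prod>j\<in>Y. cauchy_factor t (q * vr i * vi j))"

text \<open>The sum of all positive powers of \<open>s w / u\<^sub>b\<close>.\<close>

definition pos_powers :: "lser \<Rightarrow> nat \<Rightarrow> lser \<Rightarrow> lser"
  where "pos_powers s b w = s * w * vi b * iv (s * w * vi b)"

text \<open>Equals \<open>(t;t)\<^sub>n / (t;t)\<^sub>n\<^sub>-\<^sub>l\<close> for \<open>l \<le> n\<close>, see \<open>falling_q_pochhammer\<close>.\<close>

fun falling :: "'a::comm_ring_1 \<Rightarrow> nat \<Rightarrow> nat \<Rightarrow> 'a"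
  where "falling t l 0 = (if l = 0 then 1 else 0)"
  | "falling t l (Suc n) = t ^ l * falling t l n + (1 - t ^ l) * falling t (l - 1) n"

lemma q_pochhammer_Suc: "q_pochhammer t t (Suc n) = q_pochhammer t t n * (1 - t ^ Suc n)"
  by (simp add: q_pochhammer_def mult.commute)

lemma q_pochhammer_0 [simp]: "q_pochhammer t t 0 = 1"
  by (simp add: q_pochhammer_def)

lemma falling_eq_0: "n < l \<Longrightarrow> falling t l n = 0"
  by (induction n arbitrary: l) auto

lemma falling_self: "falling t n n = q_pochhammer t t n"
  by (induction n) (simp_all add: falling_eq_0 q_pochhammer_Suc mult.commute)

lemma falling_q_pochhammer:
  "l \<le> n \<Longrightarrow> falling t l n * q_pochhammer t t (n - l) = q_pochhammer t t n"
proof (induction n arbitrary: l)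
  case (Suc n)
  consider "l = 0" | "l = Suc n" | m where "l = Suc m" "m < n"
    using Suc.prems by (metis Suc_le_mono le_neq_implies_less not0_implies_Suc)
  then show ?case
  proof cases
    case 1
    have "falling t 0 k = 1" for k by (induction k) simp_all
    then show ?thesis using 1 by simp
  next
    case 2
    then show ?thesis by (simp add: falling_self del: falling.simps)
  next
    case 3
    then have d: "Suc n - l = n - m" "n - m = Suc (n - l)" "l - 1 = m"
      by auto
    have P: "q_pochhammer t t (n - m) = q_pochhammer t t (n - l) * (1 - t ^ (n - m))"
      by (subst d(2), subst q_pochhammer_Suc, simp only: d(2))
    have e: "t ^ l * t ^ (n - m) = t ^ Suc n"
    proof -
      have "l + (n - m) = Suc n" using 3 by simp
      then show ?thesis by (metis power_add)
    qed
    have "falling t l (Suc n) * q_pochhammer t t (Suc n - l) =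
        t ^ l * (falling t l n * q_pochhammer t t (n - l)) * (1 - t ^ (n - m)) +
        (1 - t ^ l) * (falling t m n * q_pochhammer t t (n - m))"
      unfolding falling.simps d(1,3) P by (simp only: algebra_simps)
    also have "\<dots> = (t ^ l * (1 - t ^ (n - m)) + (1 - t ^ l)) * q_pochhammer t t n"
      using 3 Suc.IH[of l] Suc.IH[of m] by (simp add: algebra_simps)
    also have "t ^ l * (1 - t ^ (n - m)) + (1 - t ^ l) = 1 - t ^ Suc n"
      by (simp only: right_diff_distrib e mult_1_right) simp
    finally show ?thesis by (simp only: q_pochhammer_Suc mult.commute)
  qed
qed simp

lemma hom_falling:
  assumes "unital_ring_hom h"
  shows "h (falling t l n) = falling (h t) l n"
  by (induction n arbitrary: l) (simp_all add: unital_ring_hom_simps[OF assms])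

lemma falling_0: "l \<le> n \<Longrightarrow> falling 0 l n = 1"
  by (induction n arbitrary: l) (auto simp: power_0_left)

lemma supported_cauchy_factor:
  "submonoid M \<Longrightarrow> t \<in> supported M \<Longrightarrow> z \<in> supported M \<Longrightarrow> small z \<Longrightarrow> cauchy_factor t z \<in> supported M"
  unfolding cauchy_factor_def
  by (intro supported_times supported_diff supported_iv supported_1)

lemma cauchy_factor_hl_factor:
  assumes "small t" "small z"
  shows "cauchy_factor t z * hl_factor t z = 1"
proof -
  have "cauchy_factor t z * hl_factor t z = ((1 - t * z) * iv (t * z)) * ((1 - z) * iv z)"
    by (simp only: cauchy_factor_def hl_factor_def mult_ac)
  then show ?thesis by (simp only: iv_mult assms small_mult mult_1)
qed

lemma supported_pos_powers:
  assumes "submonoid M" "s \<in> supported M" "w \<in> supported M" "vi b \<in> supported M" "small s"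
  shows "pos_powers s b w \<in> supported M"
  unfolding pos_powers_def
  by (intro supported_times supported_iv assms small_mult)

lemma supported_inj_sum:
  assumes "submonoid M" "\<And>b y. b \<in> B \<Longrightarrow> y \<in> Y \<Longrightarrow> f b y \<in> supported M"
  shows "inj_sum f B Y \<in> supported M"
  unfolding inj_sum_def
  by (intro supported_sum supported_prod assms) (auto simp: inj_maps_def PiE_iff)

lemma ev_hl_factor:
  assumes t: "scalar t" "small t" and "w \<in> supported (free_of {j})" "l \<noteq> j"
  shows "ev j w (hl_factor t (vr j * vi l)) (hl_factor t (w * vi l))"
  unfolding hl_factor_def using assms(3,4)
  by (intro ev_mult ev_diff ev_iv ev_const[OF supported_1] ev_const[OF vi_supported]
      ev_const[OF scalar_supported] ev_vr submonoid_free_of t small_mult) auto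

lemma ev_pos_powers:
  assumes s: "scalar s" "small s" and "w \<in> supported (free_of {j})" "b \<noteq> j"
  shows "ev j w (pos_powers s b (vr j)) (pos_powers s b w)"
  unfolding pos_powers_def mult.assoc using assms(3,4)
  by (intro ev_mult ev_iv ev_const[OF vi_supported]
      ev_const[OF scalar_supported] ev_vr s small_mult) auto

context
  fixes q s t :: lser
  assumes q: "scalar q" "small q" "q \<noteq> 0" and s: "scalar s" "small s" and t: "scalar t" "small t"
begin

abbreviation (input) "x_part \<equiv> \<lambda>b x. pos_powers s b (q * vr x)"
abbreviation (input) "y_part \<equiv> \<lambda>b y. pos_powers s b (vr y)"

lemma small_q: "small (q * z)"
  using q(2) by (rule small_mult)

lemma supported_cauchy_kernel:
  "X \<inter> J = {} \<Longrightarrow> Y \<inter> J = {} \<Longrightarrow> cauchy_kernel q t X Y \<in> supported (free_of J)"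
  unfolding cauchy_kernel_def mult.assoc
  by (intro supported_prod supported_cauchy_factor submonoid_free_of scalar_supported t supported_times
      q small_q vr_supported vi_supported) auto

lemma supported_y_part:
  "b \<notin> J \<Longrightarrow> y \<notin> J \<Longrightarrow> y_part b y \<in> supported (free_of J)"
  by (intro supported_pos_powers submonoid_free_of scalar_supported[OF s(1)] vr_supported vi_supported s)

lemma supported_x_part:
  "b \<notin> J \<Longrightarrow> x \<notin> J \<Longrightarrow> x_part b x \<in> supported (free_of J)"
  by (intro supported_pos_powers submonoid_free_of scalar_supported[OF s(1)] vr_supported vi_supported s
      supported_times scalar_supported[OF q(1)])

text \<open>When q x_i is substituted for the eliminated variable, its Hall--Littlewood factors
  become reciprocals of the Cauchy factors of x_i. This removes x_i from the kernel, so that the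
  induction can continue with one variable fewer on each side.\<close>

lemma cauchy_kernel_remove:
  assumes "finite X" "i \<in> X"
  shows "(\<Prod>l\<in>Y. hl_factor t (q * vr i * vi l)) * cauchy_kernel q t X Y = cauchy_kernel q t (X - {i}) Y"
proof -
  have "cauchy_factor t (q * vr i * vi l) * hl_factor t (q * vr i * vi l) = 1" for l
    by (rule cauchy_factor_hl_factor) (auto intro: t small_mult small_q)
  then have "(\<Prod>l\<in>Y. cauchy_factor t (q * vr i * vi l)) * (\<Prod>l\<in>Y. hl_factor t (q * vr i * vi l)) = 1"
    by (simp flip: prod.distrib)
  then show ?thesis
    unfolding cauchy_kernel_def prod.remove[OF assms] by (simp add: mult_ac)
qed

text \<open>Induction on \<open>ys\<close>: the partial fractions in u_j have one term at u_j = 0,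
  which keeps \<open>X\<close>, and one at each u_j = q x_i, which removes x_i. The residue
  coefficients add up to 1 - t^|X| after division by \<open>?V\<close>, giving the recursion of
  \<open>falling\<close>. Including |B| > |X|, with value 0, disposes of the terms in which u_j is
  not matched with a row.\<close>

lemma reproducing_kernel:
  assumes "distinct ys" "finite X" "finite B" "X \<inter> set ys = {}" "B \<inter> set ys = {}" "card X \<le> card B"
  shows "ct (set ys) (cauchy_kernel q t X (set ys) * hl_weight t ys * inj_sum y_part B (set ys)) =
    (if card B = card X then falling t (card X) (length ys) * inj_sum x_part B X else 0)"
  using assms
proof (induction ys arbitrary: X B)
  case Nil
  show ?case
  proof (cases "B = {}")
    case True
    then show ?thesis
      using Nil by (simp add: cauchy_kernel_def ct_id supported_1 submonoid_free_of)
  next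
    case False
    then show ?thesis
      using Nil by (auto simp: inj_sum_eq_0 card_gt_0_iff)
  qed
next
  case (Cons j ys)
  let ?Y = "set ys" and ?V = "sq_vandermonde (\<lambda>i. q * vr i) X" and ?N = "card X"
  let ?C = "pf_coeff t (\<lambda>i. q * vr i) X"
  let ?H = "cauchy_kernel q t X ?Y * hl_weight t ys"
  let ?P = "inj_sum y_part B ?Y" and ?Pb = "\<lambda>b. inj_sum y_part (B - {b}) ?Y"
  have X: "q * vr i \<noteq> 0 \<and> small (q * vr i) \<and> q * vr i \<in> supported (free_of J)" if "i \<notin> J" for i J
    using that by (auto simp: q vr_neq_0 small_q intro!: supported_times submonoid_free_of
        scalar_supported[OF q(1)] vr_supported)
  have inj: "inj_on (\<lambda>i. q * vr i) X"
    by (rule inj_onI) (simp add: q(3) inj_eq[OF inj_vr])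
  have j: "j \<notin> ?Y" "j \<notin> X" "j \<notin> B" "distinct ys" "X \<inter> ?Y = {}" "B \<inter> ?Y = {}"
    using Cons.prems by auto
  \<comment> \<open>\<open>g\<close> is what multiplies the Cauchy factors of u_j, with the
    permanent expanded along the column \<open>j\<close>; \<open>g' i\<close> is its value at u_j =
    q x_i.\<close>
  define g where "g = (\<Prod>l\<in>?Y. hl_factor t (vr j * vi l)) * (?P + (\<Sum>b\<in>B. y_part b j * ?Pb b)) * ?H"
  define g' where "g' = (\<lambda>i. (\<Prod>l\<in>?Y. hl_factor t (q * vr i * vi l)) *
    (?P + (\<Sum>b\<in>B. x_part b i * ?Pb b)) * ?H)"
  have H: "?H \<in> supported (free_of {j})"
    using j by (intro supported_times submonoid_free_of supported_cauchy_kernel supported_hl_weight t) auto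
  have P: "inj_sum y_part B' ?Y \<in> supported (free_of {j})" if "B' \<subseteq> B" for B'
    using j that by (intro supported_inj_sum submonoid_free_of supported_y_part) auto
  have ev: "ev j w g ((\<Prod>l\<in>?Y. hl_factor t (w * vi l)) *
      (?P + (\<Sum>b\<in>B. pos_powers s b w * ?Pb b)) * ?H)" if "w \<in> supported (free_of {j})" for w
    unfolding g_def using j that
    by (intro ev_mult ev_prod ev_add ev_sum ev_hl_factor t ev_pos_powers s ev_const P H) auto
  \<comment> \<open>At u_j = 0 the weight factors become 1 and the positive powers vanish.\<close>
  have ev0: "ev j 0 g (?P * ?H)"
    using ev[of 0] by (simp add: hl_factor_def pos_powers_def)
  have evi: "ev j (q * vr i) g (g' i)" if "i \<in> X" for i
  proof -
    have "i \<notin> {j}" using that j by auto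
    then show ?thesis unfolding g'_def using X by (intro ev) blast
  qed
  have F: "cauchy_kernel q t X (set (j # ys)) * hl_weight t (j # ys) * inj_sum y_part B (set (j # ys)) =
      (\<Prod>i\<in>X. (1 - t * (q * vr i) * vi j) * iv (q * vr i * vi j)) * g"
    using j by (simp add: cauchy_kernel_def prod.distrib cauchy_factor_def g_def
        inj_sum_insert[OF Cons.prems(3)] mult_ac)
  have Xj: "q * vr i \<noteq> 0 \<and> small (q * vr i) \<and> q * vr i \<in> supported (free_of {j})" if "i \<in> X" for i
    by (rule X) (use j that in auto)
  have "?V * ct {j} ((\<Prod>i\<in>X. (1 - t * (q * vr i) * vi j) * iv (q * vr i * vi j)) * g) =
      ?V * t ^ ?N * (?P * ?H) + (\<Sum>i\<in>X. ?C i * g' i)"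
    by (rule ct_partial_fractions[OF Cons.prems(2) inj Xj scalar_supported[OF t(1)] ev0 evi])
  then have 1: "?V * ct {j} (cauchy_kernel q t X (set (j # ys)) * hl_weight t (j # ys) *
      inj_sum y_part B (set (j # ys))) = ?V * t ^ ?N * (?P * ?H) + (\<Sum>i\<in>X. ?C i * g' i)"
    by (simp only: F)
  have sup: "q * vr i \<in> supported (free_of ?Y)" if "i \<in> X" for i
    using X[of i ?Y] j that by auto
  have V: "?V \<in> supported (free_of ?Y)"
    unfolding sq_vandermonde_def
    by (intro supported_prod supported_diff submonoid_free_of sup) auto
  have C: "?C i \<in> supported (free_of ?Y)" if "i \<in> X" for i
    unfolding pf_coeff_def using that
    by (intro supported_prod supported_diff supported_times supported_1 submonoid_free_of sup
        scalar_supported t) auto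
  have Vt: "?V * t ^ ?N \<in> supported (free_of ?Y)"
    by (intro supported_times supported_power submonoid_free_of V scalar_supported t)
  define R where "R = (if card B = ?N then inj_sum x_part B X else 0)"
  have IH0: "ct ?Y (?P * ?H) = falling t ?N (length ys) * R"
    using Cons.IH[of X B] Cons.prems j by (simp add: mult.commute R_def)
  have IHi: "ct ?Y (g' i) = falling t (?N - 1) (length ys) * R" if i: "i \<in> X" for i
  proof -
    let ?H' = "cauchy_kernel q t (X - {i}) ?Y * hl_weight t ys"
    have ci: "Suc (card (X - {i})) = ?N"
      by (rule card_Suc_Diff1[OF Cons.prems(2) i])
    have "g' i = ((\<Prod>l\<in>?Y. hl_factor t (q * vr i * vi l)) * cauchy_kernel q t X ?Y) * hl_weight t ys * ?P +
        (\<Sum>b\<in>B. x_part b i * (((\<Prod>l\<in>?Y. hl_factor t (q * vr i * vi l)) * cauchy_kernel q t X ?Y) * hl_weight t ys * ?Pb b))"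
      by (simp only: g'_def distrib_left distrib_right sum_distrib_left sum_distrib_right mult_ac)
    also have "\<dots> = ?H' * ?P + (\<Sum>b\<in>B. x_part b i * (?H' * ?Pb b))"
      by (simp only: cauchy_kernel_remove[OF Cons.prems(2) i])
    finally have "ct ?Y (g' i) = ct ?Y (?H' * ?P) + (\<Sum>b\<in>B. ct ?Y (x_part b i * (?H' * ?Pb b)))"
      by (simp only: ct_add ct_sum)
    \<comment> \<open>No row is matched with \<open>j\<close> here, so \<open>B\<close> keeps its
      size while \<open>X\<close> has lost x_i.\<close>
    also have "ct ?Y (?H' * ?P) = 0"
      using Cons.IH[of "X - {i}" B] Cons.prems j ci by auto
    also have "(\<Sum>b\<in>B. ct ?Y (x_part b i * (?H' * ?Pb b))) =
        (\<Sum>b\<in>B. falling t (?N - 1) (length ys) *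
          (if card B = ?N then x_part b i * inj_sum x_part (B - {b}) (X - {i}) else 0))"
    proof (rule sum.cong[OF refl])
      fix b assume b: "b \<in> B"
      have cb: "Suc (card (B - {b})) = card B"
        by (rule card_Suc_Diff1[OF Cons.prems(3) b])
      have "ct ?Y (x_part b i * (?H' * ?Pb b)) = x_part b i * ct ?Y (?H' * ?Pb b)"
        using b i j by (intro ct_mult supported_x_part) auto
      also have "ct ?Y (?H' * ?Pb b) = (if card (B - {b}) = card (X - {i}) then
          falling t (card (X - {i})) (length ys) * inj_sum x_part (B - {b}) (X - {i}) else 0)"
        using Cons.prems j ci cb by (intro Cons.IH) auto
      finally show "ct ?Y (x_part b i * (?H' * ?Pb b)) = falling t (?N - 1) (length ys) *
          (if card B = ?N then x_part b i * inj_sum x_part (B - {b}) (X - {i}) else 0)"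
        by (simp add: ci[symmetric] cb[symmetric] mult_ac)
    qed
    also have "\<dots> = falling t (?N - 1) (length ys) * R"
    proof (cases "card B = ?N")
      case True
      \<comment> \<open>Expansion along the column \<open>i\<close>: without it there are fewer
        columns than rows, so the sum over \<open>b\<close> is the full permanent, whichever
        \<open>i\<close> was removed.\<close>
      have "inj_sum x_part B (insert i (X - {i})) = inj_sum x_part B (X - {i}) +
          (\<Sum>b\<in>B. x_part b i * inj_sum x_part (B - {b}) (X - {i}))"
        using Cons.prems by (intro inj_sum_insert) auto
      moreover have "inj_sum x_part B (X - {i}) = 0"
        using Cons.prems True ci by (intro inj_sum_eq_0) auto
      ultimately show ?thesis
        using True i by (simp add: R_def insert_absorb sum_distrib_left)
    qed (simp add: R_def)
    finally show ?thesis by simp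
  qed
  let ?F = "cauchy_kernel q t X (set (j # ys)) * hl_weight t (j # ys) * inj_sum y_part B (set (j # ys))"
  have "?V * ct (set (j # ys)) ?F = ?V * ct ?Y (ct {j} ?F)"
    by (simp only: ct_ct list.set insert_is_Un[of j ?Y] Un_commute)
  also have "\<dots> = ct ?Y (?V * t ^ ?N * (?P * ?H) + (\<Sum>i\<in>X. ?C i * g' i))"
    by (simp only: ct_mult[OF V, symmetric] 1)
  also have "\<dots> = ?V * t ^ ?N * ct ?Y (?P * ?H) + (\<Sum>i\<in>X. ?C i * ct ?Y (g' i))"
    unfolding ct_add ct_sum ct_mult[OF Vt] by (simp add: ct_mult[OF C])
  also have "\<dots> = ?V * t ^ ?N * (falling t ?N (length ys) * R) +
      (\<Sum>i\<in>X. ?C i) * (falling t (?N - 1) (length ys) * R)"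
    by (simp add: IH0 IHi sum_distrib_right)
  also have "(\<Sum>i\<in>X. ?C i) = ?V * (1 - t ^ ?N)"
    using q vr_neq_0 by (intro sum_pf_coeff Cons.prems inj) auto
  also have "?V * t ^ ?N * (falling t ?N (length ys) * R) +
      ?V * (1 - t ^ ?N) * (falling t (?N - 1) (length ys) * R) =
      ?V * (falling t ?N (length (j # ys)) * R)"
    by (simp add: algebra_simps)
  \<comment> \<open>The denominator \<open>?V\<close> carried along is cancelled only now; it is
    nonzero because the x_i are distinct variables and q is nonzero.\<close>
  finally have "ct (set (j # ys)) ?F = falling t ?N (length (j # ys)) * R"
    using sq_vandermonde_nonzero[OF Cons.prems(2) inj] q vr_neq_0
    by (simp only: mult_cancel_left) auto
  then show ?case by (simp add: R_def)
qed

end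

section \<open>Expansion of the diagonal kernel\<close>

text \<open>The variable with index \<open>\<xi> y\<close> occurs in the factor \<open>F y\<close>
  alone, so constant terms can be taken factor by factor.\<close>

lemma ct_prod_independent:
  assumes "finite A" "inj_on \<xi> A"
    and "\<And>y. y \<in> A \<Longrightarrow> ct {\<xi> y} (F y) = F' y"
    and "\<And>y y'. y \<in> A \<Longrightarrow> y' \<in> A \<Longrightarrow> y' \<noteq> y \<Longrightarrow> F y \<in> supported (free_of {\<xi> y'})"
    and "\<And>y. y \<in> A \<Longrightarrow> F' y \<in> supported (free_of (\<xi> ` A))"
    and "H \<in> supported (free_of (\<xi> ` A))"
  shows "ct (\<xi> ` A) ((\<Prod>y\<in>A. F y) * H) = (\<Prod>y\<in>A. F' y) * H"
  using assms
proof (induction A arbitrary: H)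
  case empty
  then show ?case by (simp add: ct_id)
next
  case (insert a A)
  have mono: "free_of (\<xi> ` insert a A) \<subseteq> free_of (\<xi> ` A)" "free_of (\<xi> ` insert a A) \<subseteq> free_of {\<xi> a}"
    by (auto simp: free_of_def)
  have free: "(\<Prod>y\<in>A. F y) * H \<in> supported (free_of {\<xi> a})"
    using insert.hyps
    by (intro supported_times supported_prod submonoid_free_of insert.prems
        supported_mono[OF insert.prems(5) mono(2)]) auto
  have "ct (\<xi> ` insert a A) ((\<Prod>y\<in>insert a A. F y) * H) =
      ct (\<xi> ` A) (ct {\<xi> a} (F a * ((\<Prod>y\<in>A. F y) * H)))"
    using insert.hyps by (simp add: ct_ct mult.assoc)
  also have "\<dots> = ct (\<xi> ` A) ((\<Prod>y\<in>A. F y) * (F' a * H))"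
    by (simp only: ct_mult'[OF free] insert.prems(2)[OF insertI1], simp only: mult_ac)
  also have "\<dots> = (\<Prod>y\<in>A. F' y) * (F' a * H)"
    by (intro insert.IH insert.prems supported_times submonoid_free_of
        supported_mono[OF insert.prems(4) mono(1)] supported_mono[OF insert.prems(5) mono(1)])
      (use insert.prems(1) in auto)
  finally show ?case using insert.hyps by (simp add: mult_ac)
qed

text \<open>The leftover sets A' - A and A - A' have equal size and are matched arbitrarily. This is
  used because \<open>rename\<close> acts through permutations of all indices.\<close>

lemma bij_extension:
  assumes "finite A" "finite A'" "bij_betw f A A'"
  obtains p where "bij p" "\<And>x. x \<in> A \<Longrightarrow> p x = f x" "\<And>x. x \<notin> A \<union> A' \<Longrightarrow> p x = x"
proof -
  have "card A = card A'" using assms(3) by (rule bij_betw_same_card)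
  then have "card (A' - A) = card (A - A')"
    using assms(1,2) by (simp add: card_Diff_subset_Int Int_commute)
  then obtain g where g: "bij_betw g (A' - A) (A - A')"
    using assms(1,2) finite_same_card_bij by blast
  define p where "p = (\<lambda>x. if x \<in> A then f x else if x \<in> A' then g x else x)"
  have "bij_betw p A A'"
    by (rule bij_betw_cong[THEN iffD1, OF _ assms(3)]) (simp add: p_def)
  moreover have "bij_betw p (A' - A) (A - A')"
    by (rule bij_betw_cong[THEN iffD1, OF _ g]) (simp add: p_def)
  ultimately have "bij_betw p (A \<union> (A' - A)) (A' \<union> (A - A'))"
    by (rule bij_betw_combine) auto
  moreover have "bij_betw p (- (A \<union> A')) (- (A \<union> A'))"
    by (rule bij_betw_cong[THEN iffD1, OF _ bij_betw_id]) (simp add: p_def)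
  ultimately have "bij_betw p (A \<union> (A' - A) \<union> - (A \<union> A')) (A' \<union> (A - A') \<union> - (A \<union> A'))"
    by (rule bij_betw_combine) auto
  moreover have "A \<union> (A' - A) \<union> - (A \<union> A') = UNIV" "A' \<union> (A - A') \<union> - (A \<union> A') = UNIV"
    by auto
  ultimately have "bij p" by simp
  then show ?thesis by (rule that) (simp_all add: p_def)
qed

lemma inj_sum_1: "finite S \<Longrightarrow> finite B \<Longrightarrow> card B = card S \<Longrightarrow> inj_sum (\<lambda>_ _. 1) B S = of_nat (fact (card S))"
proof (induction S arbitrary: B rule: finite_induct)
  case (insert j S)
  have "inj_sum (\<lambda>_ _. 1 :: 'c) (B - {b}) S = of_nat (fact (card S))" if "b \<in> B" for b
    using that insert by (intro insert.IH) auto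
  then have "inj_sum (\<lambda>_ _. 1 :: 'c) B (insert j S) = of_nat (card B) * of_nat (fact (card S))"
    using insert by (simp add: inj_sum_insert inj_sum_eq_0)
  also have "\<dots> = of_nat (fact (card (insert j S)))"
    unfolding insert.prems(2) card_insert_disjoint[OF insert.hyps] fact_Suc of_nat_mult of_nat_id ..
  finally show ?case .
qed simp

lemma inj_maps_image_subset: "\<sigma> \<in> inj_maps B Y \<Longrightarrow> \<sigma> ` B \<subseteq> Y \<and> card (\<sigma> ` B) = card B"
  by (auto simp: inj_maps_def card_image)

lemma card_inj_maps_image:
  assumes "finite Y" "finite B" "S \<subseteq> Y" "card S = card B"
  shows "card {\<sigma> \<in> inj_maps B Y. \<sigma> ` B = S} = fact (card B)"
proof -
  have S: "finite S" using assms finite_subset by blast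
  have "{\<sigma> \<in> inj_maps B Y. \<sigma> ` B = S} = inj_maps B S"
  proof (intro set_eqI iffI)
    fix \<sigma> assume "\<sigma> \<in> {\<sigma> \<in> inj_maps B Y. \<sigma> ` B = S}"
    then show "\<sigma> \<in> inj_maps B S" by (auto simp: inj_maps_def PiE_iff)
  next
    fix \<sigma> assume \<sigma>: "\<sigma> \<in> inj_maps B S"
    have "\<sigma> ` B = S"
      using inj_maps_image_subset[OF \<sigma>] assms(4) S by (simp add: card_subset_eq)
    then show "\<sigma> \<in> {\<sigma> \<in> inj_maps B Y. \<sigma> ` B = S}"
      using \<sigma> assms(3) by (auto simp: inj_maps_def PiE_iff)
  qed
  moreover have "inj_sum (\<lambda>_ _. 1 :: nat) B S = fact (card B)"
    by (simp add: inj_sum_1[OF S assms(2)] assms(4) del: One_nat_def)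
  ultimately show ?thesis by (simp add: inj_sum_def)
qed

lemma sum_inj_maps_image:
  fixes V :: "'c set \<Rightarrow> 'a::comm_semiring_1"
  assumes "finite Y" "finite B"
  shows "(\<Sum>\<sigma>\<in>inj_maps B Y. V (\<sigma> ` B)) = of_nat (fact (card B)) * (\<Sum>S | S \<subseteq> Y \<and> card S = card B. V S)"
proof -
  let ?T = "{S. S \<subseteq> Y \<and> card S = card B}"
  have "(\<Sum>\<sigma>\<in>inj_maps B Y. V (\<sigma> ` B)) = (\<Sum>S\<in>?T. \<Sum>\<sigma> | \<sigma> \<in> inj_maps B Y \<and> \<sigma> ` B = S. V (\<sigma> ` B))"
    using assms inj_maps_image_subset
    by (intro sum.group[symmetric] finite_inj_maps) fastforce+
  also have "\<dots> = (\<Sum>S\<in>?T. of_nat (fact (card B)) * V S)"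
  proof (rule sum.cong[OF refl])
    fix S assume S: "S \<in> ?T"
    have "(\<Sum>\<sigma> | \<sigma> \<in> inj_maps B Y \<and> \<sigma> ` B = S. V (\<sigma> ` B)) = (\<Sum>\<sigma> | \<sigma> \<in> inj_maps B Y \<and> \<sigma> ` B = S. V S)"
      by (rule sum.cong) auto
    also have "\<dots> = of_nat (card {\<sigma> \<in> inj_maps B Y. \<sigma> ` B = S}) * V S"
      by simp
    finally show "(\<Sum>\<sigma> | \<sigma> \<in> inj_maps B Y \<and> \<sigma> ` B = S. V (\<sigma> ` B)) = of_nat (fact (card B)) * V S"
      using S card_inj_maps_image[OF assms, of S] by simp
  qed
  finally show ?thesis by (simp only: sum_distrib_left)
qed

lemma rename_pos_powers:
  "scalar s \<Longrightarrow> small s \<Longrightarrow> bij p \<Longrightarrow> rename p (pos_powers s b w) = pos_powers s (p b) (rename p w)"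
  by (simp add: pos_powers_def rename_simps rename_iv small_mult rename_scalar rename_vi)

lemma rename_cauchy_factor:
  "scalar t \<Longrightarrow> bij p \<Longrightarrow> small z \<Longrightarrow> rename p (cauchy_factor t z) = cauchy_factor t (rename p z)"
  by (simp add: cauchy_factor_def rename_simps rename_iv rename_scalar)

lemma rename_cauchy_kernel:
  assumes q: "scalar q" "small q" and t: "scalar t" and p: "bij p"
  shows "rename p (cauchy_kernel q t X Y) = cauchy_kernel q t (p ` X) (p ` Y)"
proof -
  have "inj_on p A" for A
    using p by (meson bij_is_inj inj_on_subset subset_UNIV)
  then show ?thesis
    by (simp add: cauchy_kernel_def rename_simps[OF p] rename_cauchy_factor[OF t p] small_mult q(2)
        rename_vr[OF p] rename_vi[OF p] rename_scalar[OF p] q(1) prod.reindex)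
qed

lemma rename_hl_weight:
  assumes t: "scalar t" "small t" and p: "bij p" and ys: "\<And>y. y \<in> set ys \<Longrightarrow> p y = y"
  shows "rename p (hl_weight t ys) = hl_weight t ys"
  using ys
  by (induction ys)
    (simp_all add: rename_simps[OF p] rename_hl_factor[OF t p] rename_vr[OF p] rename_vi[OF p])

text \<open>Contribution to the trace of the monomials whose exponents are positive exactly on
  \<open>S\<close>; the index \<open>\<xi> y\<close> carries the auxiliary variable x_y paired with
  u_y.\<close>

definition support_term :: "lser \<Rightarrow> lser \<Rightarrow> lser \<Rightarrow> (nat \<Rightarrow> nat) \<Rightarrow> nat list \<Rightarrow> nat set \<Rightarrow> lser"
  where "support_term q s t \<xi> ys S = ct UNIV (cauchy_kernel q t (\<xi> ` S) (set ys) * hl_weight t ys *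
    (\<Prod>y\<in>S. pos_powers s (\<xi> y) (vr y)))"

context
  fixes q s t :: lser
  assumes q: "scalar q" "small q" "q \<noteq> 0" and s: "scalar s" "small s" and t: "scalar t" "small t"
begin

text \<open>Taking the constant term against the geometric series in s u_y / x_y substitutes x_y = s
  u_y, so the diagonal kernel with parameter \<open>q * s\<close> comes from a kernel in separate
  variables. Splitting each series into 1 and its positive powers yields the sum over
  supports.\<close>

lemma ct_diagonal:
  assumes \<xi>: "inj \<xi>" "\<xi> ` set ys \<inter> set ys = {}"
  shows "ct UNIV (cauchy_kernel (q * s) t (set ys) (set ys) * hl_weight t ys) =
    (\<Sum>S\<in>Pow (set ys). support_term q s t \<xi> ys S)"
proof -
  let ?Y = "set ys"
  have \<xi>Y: "\<xi> y \<notin> ?Y" if "y \<in> ?Y" for y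
    using that \<xi>(2) by blast
  have inj: "inj_on \<xi> A" for A
    using \<xi>(1) by (meson inj_on_subset subset_UNIV)
  define K where "K = (\<lambda>y. \<Prod>j\<in>?Y. cauchy_factor t (q * vr (\<xi> y) * vi j))"
  have kernel: "cauchy_kernel q t (\<xi> ` S) ?Y = (\<Prod>y\<in>S. K y)" for S
    by (simp add: cauchy_kernel_def K_def prod.reindex[OF inj])
  have W: "hl_weight t ys \<in> supported (free_of (\<xi> ` ?Y))"
    using \<xi>(2) by (intro supported_hl_weight t) auto
  have K_free: "K y \<in> supported (free_of J)" if "\<xi> y \<notin> J" "?Y \<inter> J = {}" for y J
    unfolding K_def mult.assoc using that
    by (intro supported_prod supported_cauchy_factor submonoid_free_of scalar_supported[OF q(1)]
        scalar_supported[OF t(1)] supported_times vr_supported vi_supported small_mult q(2)) auto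
  have ev: "ev (\<xi> y) w (K y) (\<Prod>j\<in>?Y. cauchy_factor t (q * w * vi j))"
    if "w \<in> supported (free_of {\<xi> y})" "y \<in> ?Y" for y w
    unfolding K_def cauchy_factor_def mult.assoc using that \<xi>Y
    by (intro ev_prod ev_mult ev_diff ev_iv ev_const[OF supported_1] ev_const[OF vi_supported]
        ev_const[OF scalar_supported] ev_vr submonoid_free_of t q small_mult(1)) auto
  have "ct (\<xi> ` ?Y) ((\<Prod>y\<in>?Y. iv (s * vr y * vi (\<xi> y)) * K y) * hl_weight t ys) =
      (\<Prod>y\<in>?Y. \<Prod>j\<in>?Y. cauchy_factor t (q * (s * vr y) * vi j)) * hl_weight t ys"
  proof (rule ct_prod_independent[OF finite_set inj _ _ _ W])
    fix y assume y: "y \<in> ?Y"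
    have w: "s * vr y \<in> supported (free_of {\<xi> y})"
      using y \<xi>Y[OF y]
      by (intro supported_times submonoid_free_of scalar_supported[OF s(1)] vr_supported) force
    show "ct {\<xi> y} (iv (s * vr y * vi (\<xi> y)) * K y) =
        (\<Prod>j\<in>?Y. cauchy_factor t (q * (s * vr y) * vi j))"
      by (rule ct_residue[OF w _ ev[OF w y]]) (intro small_mult(1) s)
    show "(\<Prod>j\<in>?Y. cauchy_factor t (q * (s * vr y) * vi j)) \<in> supported (free_of (\<xi> ` ?Y))"
      unfolding mult.assoc using y \<xi>(2)
      by (intro supported_prod supported_cauchy_factor submonoid_free_of scalar_supported[OF q(1)]
          scalar_supported[OF s(1)] scalar_supported[OF t(1)] supported_times vr_supported
          vi_supported small_mult(1) q(2)) auto
  next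
    fix y y' assume y: "y \<in> ?Y" "y' \<in> ?Y" "y' \<noteq> y"
    then have "\<xi> y' \<noteq> \<xi> y" "\<xi> y' \<noteq> y" "?Y \<inter> {\<xi> y'} = {}"
      using \<xi>(1) \<xi>Y by (auto simp: inj_eq)
    then show "iv (s * vr y * vi (\<xi> y)) * K y \<in> supported (free_of {\<xi> y'})"
      unfolding mult.assoc
      by (intro supported_times supported_iv submonoid_free_of scalar_supported[OF s(1)]
          vr_supported vi_supported small_mult(1) s K_free) auto
  qed
  then have "ct UNIV (cauchy_kernel (q * s) t ?Y ?Y * hl_weight t ys) =
      ct UNIV ((\<Prod>y\<in>?Y. iv (s * vr y * vi (\<xi> y)) * K y) * hl_weight t ys)"
    unfolding cauchy_kernel_def mult.assoc by (metis ct_UNIV_ct)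
  also have "(\<Prod>y\<in>?Y. iv (s * vr y * vi (\<xi> y)) * K y) =
      (\<Prod>y\<in>?Y. pos_powers s (\<xi> y) (vr y) + 1) * (\<Prod>y\<in>?Y. K y)"
  proof -
    have "iv (s * vr y * vi (\<xi> y)) = pos_powers s (\<xi> y) (vr y) + 1" for y
      using iv_eq[of "s * vr y * vi (\<xi> y)"] s by (simp add: pos_powers_def small_mult add.commute)
    then show ?thesis by (simp only: prod.distrib)
  qed
  also have "(\<Prod>y\<in>?Y. pos_powers s (\<xi> y) (vr y) + 1) = (\<Sum>S\<in>Pow ?Y. \<Prod>y\<in>S. pos_powers s (\<xi> y) (vr y))"
    by (subst prod_add) simp_all
  also have "ct UNIV ((\<Sum>S\<in>Pow ?Y. \<Prod>y\<in>S. pos_powers s (\<xi> y) (vr y)) * (\<Prod>y\<in>?Y. K y) * hl_weight t ys) =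
      (\<Sum>S\<in>Pow ?Y. ct UNIV ((\<Prod>y\<in>S. pos_powers s (\<xi> y) (vr y)) * (\<Prod>y\<in>?Y. K y) * hl_weight t ys))"
    by (simp only: sum_distrib_right ct_sum)
  also have "\<dots> = (\<Sum>S\<in>Pow ?Y. support_term q s t \<xi> ys S)"
  proof (rule sum.cong[OF refl])
    fix S assume "S \<in> Pow ?Y"
    then have S: "S \<subseteq> ?Y" by simp
    let ?H = "(\<Prod>y\<in>S. K y) * hl_weight t ys * (\<Prod>y\<in>S. pos_powers s (\<xi> y) (vr y))"
    \<comment> \<open>For y outside \<open>S\<close>, only \<open>K y\<close> still involves x_y,
      and in nonnegative powers; its constant term is its value 1 at x_y = 0.\<close>
    have "ct (\<xi> ` (?Y - S)) ((\<Prod>y\<in>?Y - S. K y) * ?H) = (\<Prod>y\<in>?Y - S. 1) * ?H"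
    proof (rule ct_prod_independent)
      fix y assume y: "y \<in> ?Y - S"
      have "ev (\<xi> y) 0 (K y) 1"
        using ev[of 0 y] y by (simp add: cauchy_factor_def)
      then show "ct {\<xi> y} (K y) = 1" by (rule ct_ev_0)
      show "K y \<in> supported (free_of {\<xi> y'})" if "y' \<in> ?Y - S" "y' \<noteq> y" for y'
        using that y \<xi>(1) \<xi>Y by (intro K_free) (auto simp: inj_eq)
    next
      show "?H \<in> supported (free_of (\<xi> ` (?Y - S)))"
      proof (intro supported_times supported_prod submonoid_free_of)
        show "hl_weight t ys \<in> supported (free_of (\<xi> ` (?Y - S)))"
          using \<xi>(2) by (intro supported_hl_weight t) auto
        fix y assume y: "y \<in> S"
        show "K y \<in> supported (free_of (\<xi> ` (?Y - S)))"
          using y S \<xi> by (intro K_free) (auto simp: inj_eq)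
        show "pos_powers s (\<xi> y) (vr y) \<in> supported (free_of (\<xi> ` (?Y - S)))"
          using y S \<xi>(1) \<xi>Y
          by (intro supported_pos_powers submonoid_free_of scalar_supported[OF s(1)] s vr_supported
              vi_supported) (auto simp: inj_eq)
      qed
    qed (simp_all add: inj supported_1 submonoid_free_of)
    then have H: "ct (\<xi> ` (?Y - S)) ((\<Prod>y\<in>?Y - S. K y) * ?H) = ?H"
      by (simp only: prod.neutral_const mult_1_left)
    have "(\<Prod>y\<in>S. pos_powers s (\<xi> y) (vr y)) * (\<Prod>y\<in>?Y. K y) * hl_weight t ys =
        (\<Prod>y\<in>?Y - S. K y) * ?H"
      by (simp only: prod.subset_diff[OF S finite_set] mult_ac)
    then show "ct UNIV ((\<Prod>y\<in>S. pos_powers s (\<xi> y) (vr y)) * (\<Prod>y\<in>?Y. K y) * hl_weight t ys) =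
        support_term q s t \<xi> ys S"
      unfolding support_term_def kernel
      by (simp only: ct_UNIV_ct[of "\<xi> ` (?Y - S)" "(\<Prod>y\<in>?Y - S. K y) * ?H", symmetric] H)
  qed
  finally show ?thesis .
qed

text \<open>The auxiliary variables are dummies under the full constant term: renaming
  \<open>b\<close> to \<open>\<xi> (\<sigma> b)\<close> leaves an expression that depends on
  \<sigma> only through its image.\<close>

lemma support_term_inj_maps:
  assumes \<xi>: "inj \<xi>" and B: "finite B" "B \<inter> set ys = {}" and disj: "\<xi> ` set ys \<inter> set ys = {}"
    and \<sigma>: "\<sigma> \<in> inj_maps B (set ys)"
  shows "ct UNIV (cauchy_kernel q t B (set ys) * hl_weight t ys * (\<Prod>b\<in>B. pos_powers s b (vr (\<sigma> b)))) =
    support_term q s t \<xi> ys (\<sigma> ` B)"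
proof -
  have \<sigma>': "inj_on \<sigma> B" "\<sigma> ` B \<subseteq> set ys"
    using \<sigma> by (auto simp: inj_maps_def)
  have "bij_betw (\<xi> \<circ> \<sigma>) B (\<xi> ` \<sigma> ` B)"
    using \<xi> \<sigma>' by (intro bij_betw_trans[of \<sigma> B "\<sigma> ` B"] bij_betw_imageI) (auto intro: inj_on_subset)
  from bij_extension[OF B(1) _ this] B(1) obtain p where p: "bij p"
    "\<And>x. x \<in> B \<Longrightarrow> p x = \<xi> (\<sigma> x)" "\<And>x. x \<notin> B \<union> \<xi> ` \<sigma> ` B \<Longrightarrow> p x = x"
    by auto
  have pY: "p y = y" if "y \<in> set ys" for y
    using that B(2) disj \<sigma>' by (intro p(3)) blast
  have "p ` B = \<xi> ` \<sigma> ` B" "p ` set ys = set ys"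
    using p(2) pY by (auto simp: image_iff)
  moreover have "rename p (\<Prod>b\<in>B. pos_powers s b (vr (\<sigma> b))) =
      (\<Prod>b\<in>B. pos_powers s (\<xi> (\<sigma> b)) (vr (\<sigma> b)))"
    using p(2) pY \<sigma>'
    by (auto simp: rename_simps[OF p(1)] rename_pos_powers[OF s p(1)] rename_vr[OF p(1)] intro!: prod.cong)
  ultimately have "rename p (cauchy_kernel q t B (set ys) * hl_weight t ys * (\<Prod>b\<in>B. pos_powers s b (vr (\<sigma> b)))) =
      cauchy_kernel q t (\<xi> ` \<sigma> ` B) (set ys) * hl_weight t ys * (\<Prod>y\<in>\<sigma> ` B. pos_powers s (\<xi> y) (vr y))"
    using pY by (simp add: rename_simps[OF p(1)] rename_cauchy_kernel[OF q(1,2) t(1) p(1)] rename_hl_weight[OF t p(1)]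
        prod.reindex[OF \<sigma>'(1)])
  then show ?thesis
    unfolding support_term_def by (metis ct_UNIV_rename[OF p(1)])
qed

text \<open>Every \<open>S\<close> of size |B| is the image of |B|! injections, so the sum over
  supports becomes a permanent, to which \<open>reproducing_kernel\<close> applies. Only the factor
  \<open>falling\<close> still involves \<open>t\<close> and the number of variables.\<close>

lemma sum_support_terms:
  assumes \<xi>: "inj \<xi>" and B: "finite B" "B \<inter> set ys = {}" and disj: "\<xi> ` set ys \<inter> set ys = {}"
    and ys: "distinct ys"
  shows "of_nat (fact (card B)) * (\<Sum>S | S \<subseteq> set ys \<and> card S = card B. support_term q s t \<xi> ys S) =
    falling t (card B) (length ys) * ct UNIV (inj_sum (\<lambda>b x. pos_powers s b (q * vr x)) B B)"
proof -
  have sc: "scalar (falling t l n)" for l n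
    by (induction n arbitrary: l)
      (auto intro!: supported_add supported_times supported_diff supported_power supported_1 submonoid_0 t)
  have "of_nat (fact (card B)) * (\<Sum>S | S \<subseteq> set ys \<and> card S = card B. support_term q s t \<xi> ys S) =
      (\<Sum>\<sigma>\<in>inj_maps B (set ys). support_term q s t \<xi> ys (\<sigma> ` B))"
    by (rule sum_inj_maps_image[symmetric]) (simp_all add: B)
  also have "\<dots> = ct UNIV (cauchy_kernel q t B (set ys) * hl_weight t ys *
      inj_sum (\<lambda>b y. pos_powers s b (vr y)) B (set ys))"
    unfolding inj_sum_def sum_distrib_left ct_sum
    by (rule sum.cong[OF refl]) (simp only: support_term_inj_maps[OF \<xi> B disj])
  also have "\<dots> = ct UNIV (falling t (card B) (length ys) * inj_sum (\<lambda>b x. pos_powers s b (q * vr x)) B B)"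
    \<comment> \<open>The same set \<open>B\<close> indexes the variables x and the rows, which is
      what makes the result a trace.\<close>
    by (subst ct_UNIV_ct[of "set ys", symmetric], subst reproducing_kernel[OF q s t ys B(1) B(1) B(2) B(2)])
      simp_all
  finally show ?thesis by (simp only: scalar_ct[OF sc])
qed

end

section \<open>The constant term in terms of \<open>t\<close>-independent coefficients\<close>

text \<open>The factors with equal indices, in which the variable cancels, account for the power of
  (1 - t q) / (1 - q).\<close>

lemma cauchy_kernel_diagonal:
  assumes "finite Y"
  shows "cauchy_kernel q t Y Y = cauchy_factor t q ^ card Y *
    (\<Prod>k\<in>Y. \<Prod>l\<in>Y - {k}. cauchy_factor t (q * vr l * vi k))"
proof -
  have "cauchy_kernel q t Y Y = (\<Prod>k\<in>Y. \<Prod>l\<in>Y. cauchy_factor t (q * vr l * vi k))"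
    unfolding cauchy_kernel_def by (rule prod.swap)
  also have "\<dots> = (\<Prod>k\<in>Y. cauchy_factor t q * (\<Prod>l\<in>Y - {k}. cauchy_factor t (q * vr l * vi k)))"
    using assms by (intro prod.cong refl) (simp add: prod.remove mult.assoc)
  finally show ?thesis by (simp add: prod.distrib)
qed

lemma cauchy_factor_0: "cauchy_factor 0 z = iv z"
  by (simp add: cauchy_factor_def)

lemma hl_factor_0: "hl_factor 0 z = 1 - z"
  by (simp add: hl_factor_def)

lemma q_pochhammer_zero: "q_pochhammer 0 0 n = 1"
  by (simp add: q_pochhammer_def)

lemma symmetric_in_1: "symmetric_in Y 1"
  by (simp add: symmetric_in_def unital_ring_hom.hom_one unital_ring_hom_rename)

text \<open>Each variable, when its turn comes, occurs in nonnegative powers only, and setting it to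
  0 turns its factors into 1.\<close>

lemma ct_hl_weight:
  assumes "scalar t" "small t" "distinct ys"
  shows "ct UNIV (hl_weight t ys) = 1"
  using assms(3)
proof (induction ys)
  case Nil
  then show ?case by (simp add: ct_id supported_1 submonoid_free_of)
next
  case (Cons j ys)
  have "ev j 0 (\<Prod>l\<in>set ys. hl_factor t (vr j * vi l)) (\<Prod>l\<in>set ys. hl_factor t (0 * vi l))"
    using Cons.prems by (intro ev_prod ev_hl_factor assms) auto
  then have "ct {j} (\<Prod>l\<in>set ys. hl_factor t (vr j * vi l)) = 1"
    by (subst ct_ev_0) (auto simp: hl_factor_def)
  moreover have "hl_weight t ys \<in> supported (free_of {j})"
    using Cons.prems by (intro supported_hl_weight assms) auto
  ultimately have "ct {j} (hl_weight t (j # ys)) = hl_weight t ys"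
    by (simp add: ct_mult')
  then have "ct UNIV (hl_weight t (j # ys)) = ct UNIV (hl_weight t ys)"
    by (metis ct_UNIV_ct)
  then show ?case using Cons by simp
qed

text \<open>For l \<le> N this is N! times the coefficient e_l of the trace formula; e_l involves a
  division by l!, which N! clears over the integers. Indices beyond \<open>N\<close> keep the
  auxiliary variables apart from u_1, ..., u_N.\<close>

definition length_coeff :: "lser \<Rightarrow> lser \<Rightarrow> nat \<Rightarrow> nat \<Rightarrow> lser"
  where "length_coeff q s N l = of_nat (fact N div fact l) *
    ct UNIV (inj_sum (\<lambda>b x. pos_powers s b (q * vr x)) {N + 1..N + l} {N + 1..N + l})"

lemma scalar_length_coeff: "scalar (length_coeff q s N l)"
  unfolding length_coeff_def
  by (intro supported_times submonoid_0 supported_of_nat ct_supported[of UNIV, unfolded free_of_UNIV])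

context
  fixes q s :: lser
  assumes q: "scalar q" "small q" "q \<noteq> 0" and s: "scalar s" "small s"
begin

lemma ct_diagonal_expansion:
  assumes t: "scalar t" "small t" and "m \<le> N"
  shows "of_nat (fact N) * ct UNIV (cauchy_kernel (q * s) t {1..m} {1..m} * hl_weight t [1..<Suc m]) =
    (\<Sum>l\<le>m. falling t l m * length_coeff q s N l)"
proof -
  define \<xi> where "\<xi> = (\<lambda>y. y + N)"
  define ys where "ys = [1..<Suc m]"
  have ys: "set ys = {1..m}" "distinct ys" "length ys = m"
    by (auto simp: ys_def)
  have \<xi>: "inj \<xi>" "\<xi> ` set ys \<inter> set ys = {}"
    using \<open>m \<le> N\<close> by (auto simp: \<xi>_def inj_def ys)
  let ?V = "support_term q s t \<xi> ys"
  have "of_nat (fact N) * (\<Sum>S | S \<subseteq> set ys \<and> card S = l. ?V S) = falling t l m * length_coeff q s N l"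
    if "l \<le> m" for l
  proof -
    let ?B = "{N + 1..N + l}"
    have B: "finite ?B" "?B \<inter> set ys = {}" "card ?B = l"
      using \<open>m \<le> N\<close> by (auto simp: ys)
    have "fact l dvd (fact N :: nat)"
      using that \<open>m \<le> N\<close> by (intro fact_dvd) simp
    then have N: "(of_nat (fact N) :: lser) = of_nat (fact N div fact l) * of_nat (fact l)"
      by (metis dvd_div_mult_self of_nat_mult)
    have "of_nat (fact l) * (\<Sum>S | S \<subseteq> set ys \<and> card S = l. ?V S) =
        falling t l m * ct UNIV (inj_sum (\<lambda>b x. pos_powers s b (q * vr x)) ?B ?B)"
      using sum_support_terms[OF q s t \<xi>(1) B(1,2) \<xi>(2) ys(2)] by (simp only: B(3) ys(3))
    then show ?thesis
      by (simp only: N length_coeff_def mult.assoc mult.left_commute[of "falling t l m"])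
  qed
  moreover have "ct UNIV (cauchy_kernel (q * s) t {1..m} {1..m} * hl_weight t ys) =
      (\<Sum>l\<le>m. \<Sum>S | S \<in> Pow (set ys) \<and> card S = l. ?V S)"
  proof -
    have "card ` Pow (set ys) \<subseteq> {..m}"
      using card_mono[of "{1..m}"] by (fastforce simp: ys)
    then show ?thesis
      using ct_diagonal[OF q s t \<xi>] by (subst sum.group) (simp_all add: ys)
  qed
  ultimately show ?thesis
    by (simp add: sum_distrib_left ys_def)
qed

text \<open>Specialization to t = 0, where every \<open>falling 0 l m\<close> is 1. Kernel and
  weight combine to a Hall--Littlewood weight with parameter \<open>q * s\<close>, whose constant
  term is known. As m ranges up to the fixed \<open>N\<close>, the partial sums determine every
  coefficient.\<close>

lemma sum_length_coeff:
  assumes "m \<le> N"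
  shows "(\<Sum>l\<le>m. length_coeff q s N l) * q_pochhammer (q * s) (q * s) m = of_nat (fact N)"
proof -
  let ?Q = "q * s" and ?Y = "{1..m}" and ?ys = "[1..<Suc m]"
  have ys: "set ?ys = ?Y" "distinct ?ys" "length ?ys = m"
    by auto
  have Q: "scalar ?Q" "small ?Q"
    by (intro supported_times submonoid_0 q s, intro small_mult q)
  have z: "scalar 0" "small 0" by simp_all
  let ?K = "cauchy_kernel ?Q 0 ?Y ?Y"
  let ?C = "ct UNIV (?K * hl_weight 0 ?ys)"
  have sym: "symmetric_in ?Y ?K"
    unfolding symmetric_in_def by (auto simp: rename_cauchy_kernel[OF Q z(1)])
  have C: "ct UNIV (?K * hl_sym_weight 0 ?Y) = of_nat (fact m) * ?C"
    using symmetrization[OF z ys(2), of ?K] sym by (simp only: ys q_pochhammer_zero) simp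
  have "?K * hl_sym_weight 0 ?Y = iv ?Q ^ m * hl_sym_weight ?Q ?Y"
  proof -
    have "(\<Prod>k\<in>?Y. \<Prod>l\<in>?Y - {k}. iv (?Q * vr l * vi k)) * (\<Prod>k\<in>?Y. \<Prod>l\<in>?Y - {k}. 1 - vr l * vi k) =
        hl_sym_weight ?Q ?Y"
      by (simp only: hl_sym_weight_def hl_factor_def prod.distrib[symmetric] mult_ac)
    then show ?thesis
      by (simp add: cauchy_kernel_diagonal cauchy_factor_0 hl_factor_0 hl_sym_weight_def[of 0] mult.assoc)
  qed
  moreover have "scalar (iv ?Q ^ m)"
    by (intro supported_power supported_iv submonoid_0 Q)
  ultimately have "of_nat (fact m) * ?C = iv ?Q ^ m * ct UNIV (hl_sym_weight ?Q ?Y)"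
    using C by (simp add: scalar_ct)
  then have "of_nat (fact m) * (?C * q_pochhammer ?Q ?Q m) =
      iv ?Q ^ m * (ct UNIV (1 * hl_sym_weight ?Q ?Y) * q_pochhammer ?Q ?Q m)"
    by (simp only: mult.assoc[symmetric] mult_1_left)
  \<comment> \<open>Second use of \<open>symmetrization\<close>, now with parameter
    \<open>q * s\<close> and the constant symmetric function 1.\<close>
  also have "ct UNIV (1 * hl_sym_weight ?Q ?Y) * q_pochhammer ?Q ?Q m = of_nat (fact m) * (1 - ?Q) ^ m"
    using symmetrization[OF Q ys(2) symmetric_in_1] ct_hl_weight[OF Q ys(2)] by (simp only: ys) simp
  also have "iv ?Q ^ m * (of_nat (fact m) * (1 - ?Q) ^ m) = of_nat (fact m) * ((1 - ?Q) * iv ?Q) ^ m"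
    by (simp only: power_mult_distrib mult_ac)
  also have "\<dots> = of_nat (fact m) * 1"
    by (simp only: iv_mult Q power_one)
  finally have *: "?C * q_pochhammer ?Q ?Q m = 1"
    by (subst (asm) mult_cancel_left) simp
  have "(\<Sum>l\<le>m. length_coeff q s N l) = of_nat (fact N) * ?C"
    using ct_diagonal_expansion[OF z assms] by (simp add: falling_0)
  then show ?thesis by (simp only: mult.assoc * mult_1_right)
qed

end

section \<open>Descent to power series in \<open>q\<close> and \<open>t\<close>\<close>

text \<open>Injective with image the scalars, so identities between scalars of \<open>lser\<close>
  can be read back as identities of series in q and t.\<close>

definition embed :: "int fps2 \<Rightarrow> lser"
  where "embed = fps_map (fps_map (Poly_Mapping.single 0))"

lemma unital_ring_hom_embed: "unital_ring_hom embed"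
proof -
  have "unital_ring_hom (Poly_Mapping.single (0 :: nat \<Rightarrow>\<^sub>0 int) :: int \<Rightarrow> _)"
    by unfold_locales (simp_all add: single_add mult_single)
  then show ?thesis by (simp add: embed_def unital_ring_hom_fps_map)
qed

lemma embed_constant_term: "embed (constant_term F) = ct UNIV F"
  by (rule lser_eqI) (simp add: embed_def constant_term_def lookup_ct free_of_UNIV lookup_single when_def)

lemma constant_term_embed: "constant_term (embed c) = c"
  by (simp add: embed_def constant_term_def fps_eq_iff)

lemma embed_inject: "embed c = embed d \<longleftrightarrow> c = d"
  by (metis constant_term_embed)

lemma embed_var: "embed var_q = var_q" "embed var_t = var_t"
proof -
  have "unital_ring_hom (Poly_Mapping.single (0 :: nat \<Rightarrow>\<^sub>0 int) :: int \<Rightarrow> _)"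
    by unfold_locales (simp_all add: single_add mult_single)
  then show "embed var_q = var_q" "embed var_t = var_t"
    by (simp_all add: embed_def fps_map_map_var_q fps_map_var_t unital_ring_hom_fps_map)
qed

lemma embed_scalar: "scalar c \<Longrightarrow> embed (constant_term c) = c"
  by (simp add: embed_constant_term ct_id free_of_UNIV)

section \<open>The product of the identity as kernel times weight\<close>

definition root_product :: "lser \<Rightarrow> lser \<Rightarrow> nat \<Rightarrow> lser"
  where "root_product q t n =
    (\<Prod>(i, j) \<in> {(i, j). i \<in> {1..n} \<and> j \<in> {1..n} \<and> i \<noteq> j}.
       ((1 - q * t * (var_u i \<oslash> var_u j)) * (1 - (var_u i \<oslash> var_u j)))
       \<oslash> ((1 - q * (var_u i \<oslash> var_u j)) * (1 - t * (var_u i \<oslash> var_u j))))"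

lemma var_u_divide_eq: "var_u i \<oslash> var_u j = vr i * vi j"
  unfolding var_u_divide mon_diff[symmetric] mon_def ..

lemma root_product_eq:
  assumes "small q" "small t"
  shows "root_product q t n = (\<Prod>k\<in>{1..n}. \<Prod>l\<in>{1..n} - {k}.
    cauchy_factor t (q * vr l * vi k) * hl_factor t (vr l * vi k))"
proof -
  have 1: "((1 - q * t * z) * (1 - z)) \<oslash> ((1 - q * z) * (1 - t * z)) =
      cauchy_factor t (q * z) * hl_factor t z" for z
  proof -
    have "(1 - q * z) * (1 - t * z) * (iv (q * z) * iv (t * z)) =
        ((1 - q * z) * iv (q * z)) * ((1 - t * z) * iv (t * z))"
      by (simp only: mult_ac)
    also have "\<dots> = 1"
      by (simp only: iv_mult small_mult assms mult_1_left)
    finally have "unit_inverse ((1 - q * z) * (1 - t * z)) = iv (q * z) * iv (t * z)"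
      by (rule unit_inverse_eqI)
    then show ?thesis
      by (simp only: unit_divide_def cauchy_factor_def hl_factor_def mult_ac)
  qed
  let ?f = "\<lambda>k l. cauchy_factor t (q * vr l * vi k) * hl_factor t (vr l * vi k)"
  have "root_product q t n = (\<Prod>(k, l) \<in> (SIGMA k : {1..n}. {1..n} - {k}). ?f k l)"
    unfolding root_product_def var_u_divide_eq 1
    by (rule prod.reindex_bij_witness[of _ prod.swap prod.swap]) (auto simp: mult.assoc)
  then show ?thesis by (simp add: prod.Sigma)
qed

text \<open>Denominators are cleared because n! is not invertible over the integers. Both q and s of
  the trace argument are taken to be \<open>var_q\<close>, whence \<open>Q\<close>. The witnesses
  are the constant term with the triangular weight and the coefficients
  \<open>length_coeff\<close>.\<close>

lemma constant_term_root_product: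
  fixes Q T :: "int fps2"
  defines "Q \<equiv> var_q * var_q" and "T \<equiv> var_t"
  shows "\<exists>(C :: int fps2) f.
    (1 - T * Q) ^ n * constant_term (root_product (var_q * var_q) var_t n) * q_pochhammer T T n =
      of_nat (fact n) * ((1 - Q) * (1 - T)) ^ n * C \<and>
    of_nat (fact n) * C = (\<Sum>l\<le>n. falling T l n * f l) \<and>
    (\<forall>m\<le>n. (\<Sum>l\<le>m. f l) * q_pochhammer Q Q m = of_nat (fact n))"
proof -
  let ?q = "var_q :: lser" and ?t = "var_t :: lser" and ?ys = "[1..<Suc n]"
  let ?Q = "?q * ?q" and ?Y = "{1..n}"
  note emb = unital_ring_hom_simps[OF unital_ring_hom_embed] hom_falling[OF unital_ring_hom_embed]
    embed_var
  have q: "scalar ?q" "small ?q" "?q \<noteq> 0" and t: "scalar ?t" "small ?t"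
    using small_var by (auto simp: supported_def var_q_def var_t_def fps_X_def fps_eq_iff split: if_splits)
  have Q: "scalar ?Q" "small ?Q"
    by (intro supported_times submonoid_0 q, intro small_mult q)
  have ys: "set ?ys = ?Y" "distinct ?ys" "length ?ys = n" by auto
  let ?P = "root_product ?Q ?t n" and ?K = "cauchy_kernel ?Q ?t ?Y ?Y"
  define C where "C = constant_term (?K * hl_weight ?t ?ys)"
  define f where "f = (\<lambda>l. constant_term (length_coeff ?q ?q n l))"
  have C: "embed C = ct UNIV (?K * hl_weight ?t ?ys)"
    by (simp only: C_def embed_constant_term)
  have f: "embed (f l) = length_coeff ?q ?q n l" for l
    by (simp only: f_def embed_scalar scalar_length_coeff)
  have sym: "symmetric_in ?Y ?K"
    unfolding symmetric_in_def by (auto simp: rename_cauchy_kernel[OF Q t(1)])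
  have sc: "scalar (cauchy_factor ?t ?Q ^ n)"
    by (intro supported_power supported_cauchy_factor submonoid_0 Q t)
  have "?K * hl_sym_weight ?t ?Y = cauchy_factor ?t ?Q ^ n * ?P"
    using Q t by (simp add: cauchy_kernel_diagonal root_product_eq hl_sym_weight_def prod.distrib mult.assoc)
  then have *: "cauchy_factor ?t ?Q ^ n * ct UNIV ?P * q_pochhammer ?t ?t n =
      of_nat (fact n) * (1 - ?t) ^ n * embed C"
    using symmetrization[OF t ys(2), of ?K] sym unfolding ys C by (simp add: scalar_ct[OF sc])
  \<comment> \<open>Multiplication by (1 - Q)^n clears the denominators of the diagonal factors of
    the kernel.\<close>
  have e: "(1 - ?Q) ^ n * cauchy_factor ?t ?Q ^ n = (1 - ?t * ?Q) ^ n"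
  proof -
    have "(1 - ?Q) * cauchy_factor ?t ?Q = (1 - ?t * ?Q) * ((1 - ?Q) * iv ?Q)"
      by (simp only: cauchy_factor_def mult_ac)
    then show ?thesis
      by (simp only: power_mult_distrib[symmetric] iv_mult Q mult_1_right)
  qed
  have "(1 - ?t * ?Q) ^ n * ct UNIV ?P * q_pochhammer ?t ?t n =
      (1 - ?Q) ^ n * (cauchy_factor ?t ?Q ^ n * ct UNIV ?P * q_pochhammer ?t ?t n)"
    by (simp only: e[symmetric] mult.assoc)
  also have "\<dots> = of_nat (fact n) * ((1 - ?Q) * (1 - ?t)) ^ n * embed C"
    unfolding * by (simp only: power_mult_distrib mult_ac)
  finally have "embed ((1 - T * Q) ^ n * constant_term ?P * q_pochhammer T T n) =
      embed (of_nat (fact n) * ((1 - Q) * (1 - T)) ^ n * C)"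
    by (simp only: emb embed_constant_term Q_def T_def)
  moreover have "embed (of_nat (fact n) * C) = embed (\<Sum>l\<le>n. falling T l n * f l)"
    using ct_diagonal_expansion[OF q q(1,2) t order.refl] by (simp only: emb C f T_def)
  moreover have "embed ((\<Sum>l\<le>m. f l) * q_pochhammer Q Q m) = embed (of_nat (fact n))" if "m \<le> n" for m
    using sum_length_coeff[OF q q(1,2) that] by (simp only: emb f Q_def)
  ultimately show ?thesis
    by (intro exI[of _ C] exI[of _ f] conjI allI impI) (simp_all only: embed_inject)
qed

text \<open>In terms of generating functions e = (1 - z) a and c = (1 - z) b, so both sides are the
  coefficient of z^n in (1 - z) a(z) b(z).\<close>

lemma sum_convolution_differences:
  fixes a b c e :: "nat \<Rightarrow> 'a::comm_ring_1"
  assumes e: "e 0 = a 0" "\<And>l. e (Suc l) = a (Suc l) - a l"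
    and c: "c 0 = b 0" "\<And>l. c (Suc l) = b (Suc l) - b l"
  shows "(\<Sum>l\<le>n. b (n - l) * e l) = (\<Sum>j\<le>n. a (n - j) * c j)"
proof -
  have flip: "(\<Sum>l\<le>m. b (m - l) * a l) = (\<Sum>j\<le>m. a (m - j) * b j)" for m
    by (rule sum.reindex_bij_witness[of _ "\<lambda>i. m - i" "\<lambda>i. m - i"]) (auto simp: mult.commute)
  have diff: "(\<Sum>l\<le>n. v (n - l) * w l) = (\<Sum>l\<le>n. v (n - l) * u l) -
      (case n of 0 \<Rightarrow> 0 | Suc m \<Rightarrow> \<Sum>l\<le>m. v (m - l) * u l)"
    if "w 0 = u 0" "\<And>l. w (Suc l) = u (Suc l) - u l" for u v w :: "nat \<Rightarrow> 'a"
    by (cases n) (simp_all add: that sum.atMost_Suc_shift right_diff_distrib sum_subtractf del: sum.atMost_Suc)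
  show ?thesis
    unfolding diff[of e a, OF e] diff[of c b, OF c] by (cases n) (simp_all only: flip nat.case)
qed

lemma unit_mult: "a dvd 1 \<Longrightarrow> b dvd 1 \<Longrightarrow> a * b dvd (1 :: 'a::comm_ring_1)"
  using mult_dvd_mono[of a 1 b 1] by simp

lemma unit_power: "a dvd 1 \<Longrightarrow> a ^ n dvd (1 :: 'a::comm_ring_1)"
  by (induction n) (simp_all add: unit_mult)

text \<open>With a_m = 1 / (Q;Q)_m and b_m = 1 / (T;T)_m, the partial sums give f_l / n! = a_l -
  a_(l-1), and the left-hand side is the convolution of b with these differences. The difference is
  then moved over to b, where b_j - b_(j-1) = T^j b_j.\<close>

lemma identity_from_expansion:
  fixes Q T P C :: "'a::comm_ring_1"
  assumes units: "1 - T dvd 1" "1 - Q dvd 1" "\<And>m. q_pochhammer Q Q m dvd 1"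
      "\<And>m. q_pochhammer T T m dvd 1" "(of_nat (fact n) :: 'a) dvd 1"
    and P: "(1 - T * Q) ^ n * P * q_pochhammer T T n = of_nat (fact n) * ((1 - Q) * (1 - T)) ^ n * C"
    and C: "of_nat (fact n) * C = (\<Sum>l\<le>n. falling T l n * f l)"
    and f: "\<And>m. m \<le> n \<Longrightarrow> (\<Sum>l\<le>m. f l) * q_pochhammer Q Q m = of_nat (fact n)"
  shows "(1 \<oslash> of_nat (fact n)) * ((1 - Q * T) ^ n \<oslash> ((1 - Q) ^ n * (1 - T) ^ n)) * P =
    (\<Sum>j = 0..n. T ^ j \<oslash> (q_pochhammer Q Q (n - j) * q_pochhammer T T j))" (is "?L = ?R")
proof -
  define a b where "a = (\<lambda>m. unit_inverse (q_pochhammer Q Q m))"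
    and "b = (\<lambda>m. unit_inverse (q_pochhammer T T m))"
  define D U where "D = unit_inverse (of_nat (fact n) :: 'a)"
    and "U = unit_inverse ((1 - Q) ^ n * (1 - T) ^ n)"
  have a: "q_pochhammer Q Q m * a m = 1" for m
    unfolding a_def by (intro mult_unit_inverse units)
  have b: "q_pochhammer T T m * b m = 1" for m
    unfolding b_def by (intro mult_unit_inverse units)
  have D: "of_nat (fact n) * D = 1"
    unfolding D_def by (intro mult_unit_inverse units)
  have U: "(1 - Q) ^ n * (1 - T) ^ n * U = 1"
    unfolding U_def by (intro mult_unit_inverse unit_mult unit_power units)
  have b': "falling T l n * b n = b (n - l)" if "l \<le> n" for l
  proof -
    have "b (n - l) = (q_pochhammer T T n * b n) * b (n - l)"
      by (simp only: b mult_1_left)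
    also have "\<dots> = falling T l n * b n * (q_pochhammer T T (n - l) * b (n - l))"
      by (simp only: falling_q_pochhammer[OF that, of T, symmetric] mult_ac)
    finally show ?thesis by (simp only: b mult_1_right)
  qed
  define e where "e = (\<lambda>l. D * f l)"
  have sum_e: "(\<Sum>l\<le>m. e l) = a m" if "m \<le> n" for m
  proof -
    have "(\<Sum>l\<le>m. e l) = D * ((\<Sum>l\<le>m. f l) * (q_pochhammer Q Q m * a m))"
      by (simp add: e_def a sum_distrib_left)
    also have "\<dots> = (of_nat (fact n) * D) * a m"
      by (simp only: f[OF that, symmetric] mult_ac)
    finally show ?thesis by (simp only: D mult_1_left)
  qed
  \<comment> \<open>\<open>e'\<close> continues the differences beyond n, where nothing is known
    about \<open>f\<close>; only indices up to n enter the sum.\<close>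
  define e' where "e' = (\<lambda>l. a l - (case l of 0 \<Rightarrow> 0 | Suc k \<Rightarrow> a k))"
  have e': "e l = e' l" if "l \<le> n" for l
    using that sum_e[of l] sum_e[of "l - 1"] by (cases l) (simp_all add: e'_def algebra_simps)
  have "?L * q_pochhammer T T n = D * U * ((1 - T * Q) ^ n * P * q_pochhammer T T n)"
    by (simp add: unit_divide_def D_def U_def mult_ac)
  also have "\<dots> = (of_nat (fact n) * D) * ((1 - Q) ^ n * (1 - T) ^ n * U) * C"
    unfolding P by (simp only: power_mult_distrib mult_ac)
  finally have LC: "?L * q_pochhammer T T n = C"
    by (simp only: D U mult_1_left)
  have "?L = ?L * (q_pochhammer T T n * b n)"
    by (simp only: b mult_1_right)
  also have "\<dots> = b n * C"
    by (simp only: mult.assoc[symmetric] LC) (simp only: mult.commute)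
  also have "\<dots> = b n * (D * (of_nat (fact n) * C))"
    using D by (simp add: mult.assoc[symmetric] mult.commute[of D])
  also have "\<dots> = (\<Sum>l\<le>n. falling T l n * b n * e l)"
    unfolding C by (simp add: e_def sum_distrib_left mult_ac)
  also have "\<dots> = (\<Sum>l\<le>n. b (n - l) * e' l)"
    by (rule sum.cong) (simp_all add: b' e')
  also have "\<dots> = (\<Sum>j\<le>n. a (n - j) * (T ^ j * b j))"
  proof (rule sum_convolution_differences)
    fix l
    have "b l = b l * (q_pochhammer T T (Suc l) * b (Suc l))"
      by (simp only: b mult_1_right)
    also have "\<dots> = (q_pochhammer T T l * b l) * ((1 - T ^ Suc l) * b (Suc l))"
      by (simp only: q_pochhammer_Suc mult_ac)
    also have "\<dots> = b (Suc l) - T ^ Suc l * b (Suc l)"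
      by (simp only: b mult_1_left left_diff_distrib)
    finally show "T ^ Suc l * b (Suc l) = b (Suc l) - b l"
      by simp
  qed (simp_all add: e'_def)
  also have "\<dots> = ?R"
  proof -
    have "unit_inverse (q_pochhammer Q Q m * q_pochhammer T T j) = a m * b j" for m j
    proof (rule unit_inverse_eqI)
      have "q_pochhammer Q Q m * q_pochhammer T T j * (a m * b j) =
          (q_pochhammer Q Q m * a m) * (q_pochhammer T T j * b j)"
        by (simp only: mult_ac)
      then show "q_pochhammer Q Q m * q_pochhammer T T j * (a m * b j) = 1"
        by (simp only: a b mult_1_left)
    qed
    then show ?thesis
      by (simp only: unit_divide_def atMost_atLeast0) (simp only: mult_ac)
  qed
  finally show ?thesis .
qed

section \<open>The substitution of \<open>q\<^sup>2\<close> for \<open>q\<close>\<close>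

text \<open>Composition acts on the inner series, hence on q only. The map is injective, so the
  identity may be checked after applying it.\<close>

definition square_q :: "'a::idom fps2 \<Rightarrow> 'a fps2"
  where "square_q = fps_map (\<lambda>f. f oo fps_X ^ 2)"

lemma fps_compose_X2_nth:
  "fps_nth (f oo fps_X ^ 2) n = (if even n then fps_nth f (n div 2) else (0 :: 'a::idom))"
proof -
  have "fps_nth (f oo fps_X ^ 2) n = (\<Sum>i = 0..n. if n = 2 * i then fps_nth f i else 0)"
    unfolding fps_compose_nth by (rule sum.cong) (auto simp: fps_X_power_nth simp flip: power_mult)
  also have "\<dots> = (if even n then fps_nth f (n div 2) else 0)"
  proof (cases "even n")
    case True
    then have "(n = 2 * i) = (n div 2 = i)" for i by auto
    then show ?thesis using True by simp
  next
    case False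
    then have "n \<noteq> 2 * i" for i by auto
    then show ?thesis using False by simp
  qed
  finally show ?thesis .
qed

lemma unital_ring_hom_square_q: "unital_ring_hom (square_q :: 'a::idom fps2 \<Rightarrow> _)"
  unfolding square_q_def
  by (rule unital_ring_hom_fps_map)
    (unfold_locales, simp_all add: fps_compose_add_distrib fps_compose_mult_distrib)

lemma square_q_nth:
  "fps_nth (fps_nth (square_q F) b) a = (if even a then fps_nth (fps_nth F b) (a div 2) else 0)"
  by (simp add: square_q_def fps_compose_X2_nth)

lemma square_q_inject:
  assumes "square_q F = square_q G"
  shows "F = G"
proof (intro fps_ext)
  fix b a
  show "fps_nth (fps_nth F b) a = fps_nth (fps_nth G b) a"
    using arg_cong[OF assms, of "\<lambda>H. fps_nth (fps_nth H b) (2 * a)"] by (simp add: square_q_nth)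
qed

lemma square_q_var:
  "square_q var_q = (var_q * var_q :: 'a::idom fps2)" "square_q var_t = (var_t :: 'a::idom fps2)"
  "square_q (var_u i) = (var_u i :: lser)"
proof -
  have hom: "unital_ring_hom (\<lambda>f :: 'a fps. f oo fps_X ^ 2)"
    by (unfold_locales, simp_all add: fps_compose_add_distrib fps_compose_mult_distrib)
  then show "square_q var_q = (var_q * var_q :: 'a fps2)" "square_q var_t = (var_t :: 'a fps2)"
    by (simp_all add: square_q_def var_q_def fps_map_const fps_map_var_t power2_eq_square)
  have hom': "unital_ring_hom (\<lambda>f :: int laurent_poly fps. f oo fps_X ^ 2)"
    by (unfold_locales, simp_all add: fps_compose_add_distrib fps_compose_mult_distrib)
  then show "square_q (var_u i) = (var_u i :: lser)"
    by (simp add: square_q_def var_u_def fps_map_const)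
qed

lemma square_q_constant_term: "square_q (constant_term F) = constant_term (square_q F)"
  for F :: lser
  by (auto simp: fps_eq_iff square_q_nth constant_term_def)

lemma square_q_rat_fps2: "square_q (rat_fps2 F) = rat_fps2 (square_q F)"
  by (auto simp: fps_eq_iff square_q_nth rat_fps2_def)

lemma square_q_root_product: "square_q (root_product var_q var_t n) = root_product (var_q * var_q) var_t n"
proof -
  interpret unital_ring_hom "square_q :: lser \<Rightarrow> lser"
    by (rule unital_ring_hom_square_q)
  have "(1 - var_q * x) * (1 - var_t * x) dvd (1 :: lser)" for x
    by (intro unit_mult unit_1_minus_var_q unit_1_minus_var_t)
  then show ?thesis
    unfolding root_product_def case_prod_unfold
    by (simp add: hom_prod hom_unit_divide hom_mult hom_diff hom_one unit_var_u square_q_var)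
qed

lemma rat_fps2_eq: "rat_fps2 = fps_map (fps_map of_int)"
  by (auto simp: fun_eq_iff fps_eq_iff rat_fps2_def)

lemma unital_ring_hom_of_int: "unital_ring_hom (of_int :: int \<Rightarrow> 'a::comm_ring_1)"
  by unfold_locales simp_all

lemma unital_ring_hom_rat_fps2: "unital_ring_hom rat_fps2"
  unfolding rat_fps2_eq by (intro unital_ring_hom_fps_map unital_ring_hom_of_int)

lemma rat_fps2_var: "rat_fps2 var_q = var_q" "rat_fps2 var_t = var_t"
  unfolding rat_fps2_eq
  by (intro fps_map_map_var_q fps_map_var_t unital_ring_hom_fps_map unital_ring_hom_of_int)+

text \<open>Over the rationals n! is a unit, so the cleared identities can be divided out.\<close>

lemma identity_squared:
  fixes n :: nat and Q :: "rat fps2"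
  defines "Q \<equiv> var_q * var_q"
  shows "(1 \<oslash> of_nat (fact n)) * ((1 - Q * var_t) ^ n \<oslash> ((1 - Q) ^ n * (1 - var_t) ^ n))
      * rat_fps2 (constant_term (root_product (var_q * var_q) var_t n)) =
    (\<Sum>j = 0..n. var_t ^ j \<oslash> (q_pochhammer Q Q (n - j) * q_pochhammer var_t var_t j))"
proof -
  note rat = unital_ring_hom_simps[OF unital_ring_hom_rat_fps2] hom_falling[OF unital_ring_hom_rat_fps2]
    rat_fps2_var
  obtain C :: "int fps2" and f where Cf:
    "(1 - var_t * (var_q * var_q)) ^ n * constant_term (root_product (var_q * var_q) var_t n) *
      q_pochhammer var_t var_t n = of_nat (fact n) * ((1 - var_q * var_q) * (1 - var_t)) ^ n * C"
    "of_nat (fact n) * C = (\<Sum>l\<le>n. falling var_t l n * f l)"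
    "\<forall>m\<le>n. (\<Sum>l\<le>m. f l) * q_pochhammer (var_q * var_q) (var_q * var_q) m = of_nat (fact n)"
    using constant_term_root_product[of n] by blast
  have "q_pochhammer Q Q m = square_q (q_pochhammer var_q var_q m)" for m
    by (simp add: unital_ring_hom.hom_q_pochhammer unital_ring_hom_square_q square_q_var Q_def)
  then have unit: "q_pochhammer Q Q m dvd 1" for m
    using unital_ring_hom.hom_dvd_one[OF unital_ring_hom_square_q] unit_q_pochhammer_var(1) by metis
  show ?thesis
  proof (rule identity_from_expansion)
    show "1 - var_t dvd (1 :: rat fps2)" "1 - Q dvd 1"
      using unit_1_minus_var_t[of 1] unit_1_minus_var_q[of var_q] by (simp_all add: Q_def)
    show "(1 - var_t * Q) ^ n * rat_fps2 (constant_term (root_product (var_q * var_q) var_t n)) *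
        q_pochhammer var_t var_t n = of_nat (fact n) * ((1 - Q) * (1 - var_t)) ^ n * rat_fps2 C"
      using arg_cong[OF Cf(1), of rat_fps2] by (simp only: rat Q_def)
    show "of_nat (fact n) * rat_fps2 C = (\<Sum>l\<le>n. falling var_t l n * rat_fps2 (f l))"
      using arg_cong[OF Cf(2), of rat_fps2] by (simp only: rat)
    show "(\<Sum>l\<le>m. rat_fps2 (f l)) * q_pochhammer Q Q m = of_nat (fact n)" if "m \<le> n" for m
      using arg_cong[OF Cf(3)[rule_format, OF that], of rat_fps2] by (simp only: rat Q_def)
  qed (rule unit unit_q_pochhammer_var unit_of_nat_fact)+
qed

theorem theorem5p1:
  fixes n :: nat
  assumes "n \<ge> 1"
  shows "(1 \<oslash> of_nat (fact n))
      * ((1 - var_q * var_t) ^ n \<oslash> ((1 - var_q) ^ n * (1 - var_t) ^ n))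
      * rat_fps2 (constant_term
          (\<Prod>(i, j) \<in> {(i, j). i \<in> {1..n} \<and> j \<in> {1..n} \<and> i \<noteq> j}.
             ((1 - var_q * var_t * (var_u i \<oslash> var_u j)) * (1 - (var_u i \<oslash> var_u j)))
             \<oslash> ((1 - var_q * (var_u i \<oslash> var_u j)) * (1 - var_t * (var_u i \<oslash> var_u j)))))
    = (\<Sum>j = 0..n. var_t ^ j \<oslash> (q_pochhammer var_q var_q (n - j) * q_pochhammer var_t var_t j))"
proof -
  interpret unital_ring_hom "square_q :: rat fps2 \<Rightarrow> rat fps2"
    by (rule unital_ring_hom_square_q)
  have u: "1 - var_q dvd (1 :: rat fps2)" "1 - var_t dvd (1 :: rat fps2)"
    using unit_1_minus_var_q[of 1] unit_1_minus_var_t[of 1] by simp_all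
  have units: "(1 - var_q) ^ n * (1 - var_t) ^ n dvd (1 :: rat fps2)"
    "q_pochhammer var_q var_q k * q_pochhammer var_t var_t j dvd (1 :: rat fps2)" for k j
    by (intro unit_mult unit_power u unit_q_pochhammer_var)+
  show ?thesis
    unfolding root_product_def[symmetric]
    \<comment> \<open>\<open>square_q\<close> commutes with every operation in the identity,
      quotients by units and the constant term included, so both sides become those of
      \<open>identity_squared\<close>.\<close>
    by (rule square_q_inject)
      (simp only: hom_mult hom_sum hom_unit_divide[OF unit_of_nat_fact] hom_unit_divide[OF units(1)]
        hom_unit_divide[OF units(2)] hom_power hom_diff hom_one hom_of_nat hom_q_pochhammer
        square_q_var square_q_rat_fps2 square_q_constant_term square_q_root_product identity_squared)
qed

end
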